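(* Let $H=\bigoplus_{i=1}^m H_i$ be the direct sum of separable real Hilbert spaces $H_1,\dots,H_m$, let $f\colon H\to\mathbb{R}$ be convex and differentiable, let $h_i\colon H_i\to\,]-\infty,+\infty]$ be proper, convex and lower semicontinuous for $i=1,\dots,m$, and set $h(x)=\sum_{i=1}^m h_i(x_i)$ and $F=f+h$. Let $\varepsilon=(\varepsilon_1,\dots,\varepsilon_m)$ be a $\{0,1\}^m$-valued random variable with $p_i:=\mathsf{P}(\varepsilon_i=1)>0$ for every $i$ and $\mathsf{P}(\varepsilon=(0,\dots,0))=0$, and let $(\varepsilon^n)_{n\in\mathbb{N}}$ be a sequence of independent copies of $\varepsilon$. Let $(\nu_i)_{1\le i\le m}\in\,]0,+\infty[^m$ be such that $$(\forall x,v\in H)\quad \mathsf{E}[f(x+\varepsilon\odot v)]\le f(x)+\mathsf{E}[\langle\nabla f(x),\varepsilon\odot v\rangle]+\frac12\sum_{i=1}^m p_i\nu_i\|v_i\|^2 .$$ Let $0<\gamma_i<2/\nu_i$ for every $i\in\{1,\dots,m\}$, let $x^0\in\operatorname{dom}h$ be deterministic, and let $(x^n)_{n\in\mathbb{N}}$ be the sequence of $H$-valued random variables defined by $$x_i^{n+1}=x_i^n+\varepsilon_i^n\big(\mathrm{prox}_{\gamma_i h_i}(x_i^n-\gamma_i\nabla_i f(x^n))-x_i^n\big),\qquad i=1,\dots,m,\ n\in\mathbb{N}.$$ Set $\delta=\max_{1\le i\le m}\gamma_i\nu_i$, $p_{\min}=\min_{1\le i\le m}p_i$, $F_*=\inf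 F$ and $S_*=\operatorname{argmin}F$. Then the following hold. (i) $\mathsf{E}[F(x^n)]\to F_*$. (ii) Suppose that $S_*\ne\varnothing$. Then $\mathsf{E}[F(x^n)]-F_*=o(1/n)$ and, for every integer $n\ge1$, $$\mathsf{E}[F(x^n)]-F_*\le\left[\frac{\mathrm{dist}_W^2(x^0,S_* )}{2}+\Big(\frac{\max\{1,(2-\delta)^{-1}\}}{p_{\min}}-1\Big)(F(x^0)-F_* )\right]\frac1n .$$ Moreover, there exists a random variable $x_*$ taking values in $S_*$ such that $x^n\rightharpoonup x_*$ (weak convergence in $H$) $\mathsf{P}$-almost surely.
   Context: $H=\bigoplus_i H_i$ carries the inner product $\langle x,y\rangle=\sum_{i=1}^m\langle x_i,y_i\rangle$; $\nabla_i f(x)\in H_i$ is the $i$-th component of $\nabla f(x)$. For $v\in H$ and $\epsilon\in\{0,1\}^m$, $\epsilon\odot v=(\epsilon_iv_i)_{1\le i\le m}\in H$. For a proper convex lower semicontinuous function $\varphi$ on a Hilbert space, $\mathrm{prox}_\varphi(x)=\operatorname{argmin}_z\ \varphi(z)+\frac12\|x-z\|^2$. The weighted norm is $\|x\|_W^2=\sum_{i=1}^m\frac{1}{\gamma_ip_i}\|x_i\|^2$ and $\mathrm{dist}_W(x,S)=\inf_{z\in S}\|x-z\|_W$. *)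

theory Defs
  imports "HOL-Probability.Probability"
begin

text \<open>
  The summands of the direct sum may be different Hilbert spaces. They are modelled as closed
  subspaces \<open>V i\<close> of an arbitrary ambient separable Hilbert space \<open>'a\<close>; every finite family of
  separable Hilbert spaces is of this form up to isometry. The inner product of the type
  \<open>'a ^ 'm\<close> is the sum of the inner products of the components. Functions on a summand or on the
  direct sum are relevant only on the corresponding set.
\<close>

definition direct_sum :: "('m::finite \<Rightarrow> 'a set) \<Rightarrow> ('a ^ 'm) set" where
  "direct_sum V = {x. \<forall>i. x $ i \<in> V i}"

definition mask :: "('m::finite \<Rightarrow> bool) \<Rightarrow> 'a::real_vector ^ 'm \<Rightarrow> 'a ^ 'm" (infixr "\<odot>" 75) where
  "e \<odot> v = (\<chi> i. of_bool (e i) *\<^sub>R (v $ i))"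

text \<open>The gradient of a function on a closed subspace \<open>S\<close>; it is an element of \<open>S\<close>.\<close>

definition gradient_on :: "'b::real_inner set \<Rightarrow> ('b \<Rightarrow> real) \<Rightarrow> 'b \<Rightarrow> 'b" where
  "gradient_on S f x = (THE g. g \<in> S \<and> (f has_derivative (\<lambda>v. g \<bullet> v)) (at x within S))"

definition proper_on :: "'b set \<Rightarrow> ('b \<Rightarrow> ereal) \<Rightarrow> bool" where
  "proper_on S \<phi> \<longleftrightarrow> (\<forall>x\<in>S. \<phi> x \<noteq> -\<infinity>) \<and> (\<exists>x\<in>S. \<phi> x \<noteq> \<infinity>)"

text \<open>Note that \<open>0 * \<infinity> = 0\<close> in the extended reals, so the cases \<open>u = 0\<close> and \<open>v = 0\<close> are trivial.\<close>

definition ereal_convex_on :: "'b::real_vector set \<Rightarrow> ('b \<Rightarrow> ereal) \<Rightarrow> bool" where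
  "ereal_convex_on S \<phi> \<longleftrightarrow> convex S \<and>
    (\<forall>x\<in>S. \<forall>y\<in>S. \<forall>u\<ge>0. \<forall>v\<ge>0. u + v = 1 \<longrightarrow>
      \<phi> (u *\<^sub>R x + v *\<^sub>R y) \<le> ereal u * \<phi> x + ereal v * \<phi> y)"

definition lsc_on :: "'b::topological_space set \<Rightarrow> ('b \<Rightarrow> ereal) \<Rightarrow> bool" where
  "lsc_on S \<phi> \<longleftrightarrow> (\<forall>x\<in>S. \<phi> x \<le> Liminf (at x within S) \<phi>)"

definition prox_on :: "'b::real_inner set \<Rightarrow> ('b \<Rightarrow> ereal) \<Rightarrow> 'b \<Rightarrow> 'b" where
  "prox_on S \<phi> x = arg_min_on (\<lambda>z. \<phi> z + ereal (1 / 2 * (norm (x - z))\<^sup>2)) S"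

definition argmin_set :: "'b set \<Rightarrow> ('b \<Rightarrow> ereal) \<Rightarrow> 'b set" where
  "argmin_set S F = {x. is_arg_min F (\<lambda>z. z \<in> S) x}"

definition separable_sum :: "('m::finite \<Rightarrow> 'a \<Rightarrow> ereal) \<Rightarrow> 'a ^ 'm \<Rightarrow> ereal" where
  "separable_sum h x = (\<Sum>i\<in>UNIV. h i (x $ i))"

definition norm_W :: "('m::finite \<Rightarrow> real) \<Rightarrow> ('m \<Rightarrow> real) \<Rightarrow> 'a::real_normed_vector ^ 'm \<Rightarrow> real" where
  "norm_W \<gamma> p x = sqrt (\<Sum>i\<in>UNIV. 1 / (\<gamma> i * p i) * (norm (x $ i))\<^sup>2)"

definition dist_W ::
  "('m::finite \<Rightarrow> real) \<Rightarrow> ('m \<Rightarrow> real) \<Rightarrow> 'a::real_normed_vector ^ 'm \<Rightarrow> ('a ^ 'm) set \<Rightarrow> real" where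
  "dist_W \<gamma> p x S = (INF z\<in>S. norm_W \<gamma> p (x - z))"

text \<open>
  Expectation of an extended-real-valued random variable, as the difference of the integrals of
  its positive and negative parts (\<open>e2ennreal\<close> maps negative numbers to \<open>0\<close>).
\<close>

definition ereal_expectation :: "'w measure \<Rightarrow> ('w \<Rightarrow> ereal) \<Rightarrow> ereal" where
  "ereal_expectation M X =
    enn2ereal (\<integral>\<^sup>+\<omega>. e2ennreal (X \<omega>) \<partial>M) - enn2ereal (\<integral>\<^sup>+\<omega>. e2ennreal (- X \<omega>) \<partial>M)"

definition weakly_tendsto_on :: "'b::real_inner set \<Rightarrow> (nat \<Rightarrow> 'b) \<Rightarrow> 'b \<Rightarrow> bool" where
  "weakly_tendsto_on S X l \<longleftrightarrow> (\<forall>y\<in>S. (\<lambda>n. X n \<bullet> y) \<longlonglongrightarrow> l \<bullet> y)"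

end

theory Submission
  imports Defs "HOL-Complex_Analysis.Great_Picard"
begin

text \<open>
  Write \<open>x\<^sup>+\<close> for the next iterate, \<open>\<parallel>\<cdot>\<parallel>\<close> for the weighted norm and \<open>c = max 1 (1 / (2 - \<delta>)) / p_min\<close>.
  The variational inequality of the proximity operator, the smoothness assumption and the gradient
  inequality of \<open>f\<close> yield, for every \<open>z\<close> in the domain of \<open>F\<close>,
  \<open>E \<parallel>x\<^sup>+ - z\<parallel>\<^sup>2 / 2 \<le> \<parallel>x - z\<parallel>\<^sup>2 / 2 - (F x - F z) + c (F x - E F x\<^sup>+)\<close>.
  Since \<open>E F (x\<^sup>n)\<close> decreases, summation over \<open>n\<close> gives the limit of \<open>E F (x\<^sup>n)\<close>, the explicit rate and,
  for a minimizer \<open>z\<close>, the summability of \<open>E F (x\<^sup>n) - F z\<close>, hence the rate \<open>o(1/n)\<close> and the almost sure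
  convergence \<open>F (x\<^sup>n) \<rightarrow> F z\<close>. Moreover \<open>\<parallel>x\<^sup>n - z\<parallel>\<^sup>2 / 2 + c (F (x\<^sup>n) - F z)\<close> is a nonnegative
  supermartingale, so \<open>\<parallel>x\<^sup>n - z\<parallel>\<close> converges almost surely, simultaneously for all \<open>z\<close> in a countable dense
  set of minimizers. As \<open>F\<close> is weakly lower semicontinuous, Opial's lemma applies.

  The \<open>n\<close>-th iterate is a function of finitely many inputs with finitely many values. It is
  therefore treated as a function on lists of inputs, and conditional expectations become finite sums.
\<close>

section \<open>Proximity operators and gradients in Hilbert spaces\<close>

text \<open>The distance estimate carries a nonnegative error, the sum of
  \<open>A x i - B x i / 2\<close>, in which the weights \<open>1 / (\<gamma> i * p i)\<close> have
  cancelled the probabilities; the expected decrease of \<open>F\<close> is at least the sum of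
  \<open>p i * (A x i - \<gamma> i * \<nu> i * B x i / 2)\<close>. Here \<open>A\<close> is the
  decrease of the linearized objective in a block, \<open>B\<close> is the squared step over
  \<open>\<gamma> i\<close>, and the prox inequality gives \<open>0 \<le> B \<le> A\<close>.
  Comparing the two expressions costs the factor \<open>max 1 (1 / (2 - \<delta>))\<close>,
  comparing \<open>1\<close> with \<open>p i\<close> the factor \<open>1 / p_min\<close>; this is
  the origin of \<open>c\<close>, which exceeds \<open>1 / p_min\<close> only if some
  \<open>\<gamma> i * \<nu> i\<close> exceeds 1. As \<open>F\<close> may be unbounded below or have
  no minimizer, the estimates are made against an arbitrary \<open>z\<close> of finite value and
  specialised only when a minimizer is given.\<close>

lemma lsc_on_lim_le:
  assumes lsc: "lsc_on S \<phi>" and u: "u \<in> S" and z: "\<And>n::nat. z n \<in> S" "z \<longlonglongrightarrow> u"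
    and c: "\<And>n. \<phi> (z n) \<le> c n" "c \<longlonglongrightarrow> l"
  shows "\<phi> u \<le> l"
proof (rule ccontr)
  assume "\<not> ?thesis"
  then obtain b where b: "l < b" "b < \<phi> u"
    using dense by (auto simp: not_le)
  have "b < Liminf (at u within S) \<phi>"
    using lsc u b(2) unfolding lsc_on_def by (meson less_le_trans)
  then have "eventually (\<lambda>y. b < \<phi> y) (at u within S)"
    by (rule less_LiminfD)
  then obtain T where T: "open T" "u \<in> T" "\<And>y. y \<in> T \<Longrightarrow> y \<noteq> u \<Longrightarrow> y \<in> S \<Longrightarrow> b < \<phi> y"
    unfolding eventually_at_topological by blast
  have "eventually (\<lambda>n. z n \<in> T) sequentially"
    using topological_tendstoD[OF z(2) T(1,2)] .
  then have "eventually (\<lambda>n. b \<le> c n) sequentially"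
  proof eventually_elim
    case (elim n)
    \<comment> \<open>The filter \<open>at u within S\<close> omits \<open>u\<close> itself; indices
      with \<open>z n = u\<close> are covered by \<open>b < \<phi> u\<close>.\<close>
    have "b < \<phi> (z n)"
      using T(3)[OF elim] z(1) b(2) by (cases "z n = u") auto
    then show ?case
      using c(1)[of n] by (meson less_imp_le less_le_trans)
  qed
  then have "b \<le> l"
    by (intro tendsto_lowerbound[OF c(2)]) auto
  with b(1) show False
    by simp
qed

lemma ereal_convex_onD:
  assumes "ereal_convex_on S \<phi>" "x \<in> S" "y \<in> S" "u \<ge> 0" "v \<ge> 0" "u + v = 1"
    "\<phi> x \<le> ereal a" "\<phi> y \<le> ereal b"
  shows "\<phi> (u *\<^sub>R x + v *\<^sub>R y) \<le> ereal (u * a + v * b)"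
proof -
  have "\<phi> (u *\<^sub>R x + v *\<^sub>R y) \<le> ereal u * \<phi> x + ereal v * \<phi> y"
    using assms unfolding ereal_convex_on_def by blast
  also have "\<dots> \<le> ereal u * ereal a + ereal v * ereal b"
    using assms by (intro add_mono ereal_mult_left_mono) auto
  finally show ?thesis
    by simp
qed

text \<open>A minorant that is linear in the norm is enough for the proximity operator; it needs no
  separation theorem, since lower semicontinuity bounds \<open>\<phi>\<close> from below on a ball and convexity
  propagates the bound along rays.\<close>

lemma convex_lsc_lower_bound:
  fixes \<phi> :: "'b::real_normed_vector \<Rightarrow> ereal"
  assumes proper: "proper_on S \<phi>" and cvx: "ereal_convex_on S \<phi>" and lsc: "lsc_on S \<phi>"
    and x: "x \<in> S" "\<phi> x = ereal a"
  obtains r where "r > 0" "\<And>z b. z \<in> S \<Longrightarrow> \<phi> z = ereal b \<Longrightarrow> b \<ge> a - 1 - norm (z - x) / r"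
proof -
  have "ereal (a - 1) < Liminf (at x within S) \<phi>"
  proof (rule less_le_trans)
    show "ereal (a - 1) < \<phi> x"
      by (simp add: x(2))
    show "\<phi> x \<le> Liminf (at x within S) \<phi>"
      using lsc x(1) by (simp add: lsc_on_def)
  qed
  then have "eventually (\<lambda>y. ereal (a - 1) < \<phi> y) (at x within S)"
    by (rule less_LiminfD)
  then obtain d where d: "d > 0" "\<And>y. y \<in> S \<Longrightarrow> y \<noteq> x \<Longrightarrow> dist y x < d \<Longrightarrow> ereal (a - 1) < \<phi> y"
    unfolding eventually_at by blast
  have d': "ereal (a - 1) < \<phi> y" if "y \<in> S" "dist y x < d" for y
    using d(2)[OF that(1) _ that(2)] x(2) by (cases "y = x") auto
  have "b \<ge> a - 1 - norm (z - x) / (d / 2)" if z: "z \<in> S" "\<phi> z = ereal b" for z b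
  proof (cases "norm (z - x) \<le> d / 2")
    case True
    then have "ereal (a - 1) < \<phi> z"
      using d(1) by (intro d' z) (auto simp: dist_norm)
    moreover have "norm (z - x) / (d / 2) \<ge> 0"
      using d(1) by simp
    ultimately show ?thesis
      unfolding z(2) less_ereal.simps by linarith
  next
    case False
    define N where "N = norm (z - x)"
    \<comment> \<open>\<open>t\<close> puts \<open>y\<close> at distance \<open>d / 2\<close> from
      \<open>x\<close>, inside the ball where \<open>\<phi>\<close> is bounded below; convexity
      transfers the bound from \<open>y\<close> to \<open>z\<close>.\<close>
    define t where "t = (d / 2) / N"
    have N: "N > d / 2" "N > 0"
      using False d(1) unfolding N_def by linarith+
    have t: "0 < t" "t < 1"
      using N d(1) unfolding t_def by (auto simp: divide_simps)
    define y where "y = (1 - t) *\<^sub>R x + t *\<^sub>R z"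
    have "y \<in> S"
      using cvx x(1) z(1) t unfolding ereal_convex_on_def y_def by (auto intro: convexD)
    moreover have "y - x = t *\<^sub>R (z - x)"
      by (simp add: y_def algebra_simps)
    then have "norm (y - x) = t * N"
      using t by (simp add: N_def)
    then have "dist y x < d"
      using N d(1) by (simp add: t_def dist_norm)
    ultimately have "ereal (a - 1) < \<phi> y"
      by (rule d')
    also have "\<phi> y \<le> ereal ((1 - t) * a + t * b)"
      unfolding y_def using t x z by (intro ereal_convex_onD[OF cvx]) auto
    finally have "t * (a - b) < 1"
      by (simp add: algebra_simps)
    then have "a - b < 1 / t"
      using t by (simp add: field_simps)
    moreover have "1 / t = N / (d / 2)"
      using N by (simp add: t_def)
    ultimately show ?thesis
      unfolding N_def by linarith
  qed
  then show ?thesis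
    using d(1) by (intro that[of "d / 2"]) auto
qed

section \<open>Existence and variational characterization of proximal points\<close>

lemma proper_on_real:
  assumes "proper_on S \<phi>" "z \<in> S" "\<phi> z \<le> ereal c"
  obtains b where "\<phi> z = ereal b" "b \<le> c"
  using assms by (cases "\<phi> z") (auto simp: proper_on_def)

text \<open>The parallelogram law, read as strong convexity of half the squared distance; it makes
  minimizing sequences Cauchy.\<close>

lemma half_sum_norm_sq:
  fixes x a b :: "'b::real_inner"
  shows "(norm (x - ((1/2) *\<^sub>R a + (1/2) *\<^sub>R b)))\<^sup>2 / 2
    = (norm (x - a))\<^sup>2 / 4 + (norm (x - b))\<^sup>2 / 4 - (norm (a - b))\<^sup>2 / 8"
  by (simp add: power2_norm_eq_inner inner_diff_left inner_diff_right inner_add_left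
      inner_add_right inner_commute field_simps)

text \<open>The quadratic term absorbs the linear minorant, so the infimum is finite; strong
  convexity makes a minimizing sequence converge in norm, and lower semicontinuity passes to the
  limit. Only points with a real value compete, which keeps the inequality inside the reals.\<close>

lemma proximal_point_exists:
  fixes S :: "'b::{real_inner, complete_space} set"
  assumes cl: "closed S" and proper: "proper_on S \<phi>" and cvx: "ereal_convex_on S \<phi>"
    and lsc: "lsc_on S \<phi>"
  obtains u a where "u \<in> S" "\<phi> u = ereal a"
    "\<And>z b. z \<in> S \<Longrightarrow> \<phi> z = ereal b \<Longrightarrow> a + (norm (x - u))\<^sup>2 / 2 \<le> b + (norm (x - z))\<^sup>2 / 2"
proof -
  define A where "A = {b + (norm (x - z))\<^sup>2 / 2 | z b. z \<in> S \<and> \<phi> z = ereal b}"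
  obtain y0 a0 where y0: "y0 \<in> S" "\<phi> y0 = ereal a0"
    using proper unfolding proper_on_def by (metis ereal_cases)
  obtain r where r: "r > 0"
    "\<And>z b. z \<in> S \<Longrightarrow> \<phi> z = ereal b \<Longrightarrow> b \<ge> a0 - 1 - norm (z - y0) / r"
    using convex_lsc_lower_bound[OF proper cvx lsc y0] by blast
  have "A \<noteq> {}"
    using y0 unfolding A_def by auto
  have "bdd_below A"
  proof (rule bdd_belowI)
    fix s assume "s \<in> A"
    then obtain z b where z: "z \<in> S" "\<phi> z = ereal b" "s = b + (norm (x - z))\<^sup>2 / 2"
      unfolding A_def by auto
    define N where "N = norm (x - z)"
    have "norm (z - y0) \<le> N + norm (x - y0)"
      unfolding N_def using norm_triangle_ineq4[of "x - y0" "x - z"] by simp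
    then have "norm (z - y0) / r \<le> N / r + norm (x - y0) / r"
      using r(1) by (simp add: divide_simps)
    \<comment> \<open>Young's inequality: \<open>N / r\<close> is at most
      \<open>N\<^sup>2 / 2\<close> plus a constant.\<close>
    moreover have "0 \<le> (N - 1 / r)\<^sup>2"
      by simp
    then have "N / r \<le> N\<^sup>2 / 2 + (1 / r)\<^sup>2 / 2"
      by (simp add: power2_diff)
    ultimately show "a0 - 1 - norm (x - y0) / r - (1 / r)\<^sup>2 / 2 \<le> s"
      using r(2)[OF z(1,2)] unfolding z(3) N_def by linarith
  qed
  define m where "m = Inf A"
  have m_le: "m \<le> b + (norm (x - z))\<^sup>2 / 2" if "z \<in> S" "\<phi> z = ereal b" for z b
    unfolding m_def using that by (intro cInf_lower \<open>bdd_below A\<close>) (auto simp: A_def)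
  have "\<exists>z b. z \<in> S \<and> \<phi> z = ereal b \<and> b + (norm (x - z))\<^sup>2 / 2 < m + 1 / real (Suc n)" for n
  proof -
    have "Inf A < m + 1 / real (Suc n)"
      unfolding m_def by simp
    then obtain s where "s \<in> A" "s < m + 1 / real (Suc n)"
      using cInf_lessD[OF \<open>A \<noteq> {}\<close>] by blast
    then show ?thesis
      unfolding A_def by blast
  qed
  then obtain z b where z: "\<And>n. z n \<in> S" and b: "\<And>n. \<phi> (z n) = ereal (b n)"
    and zb: "\<And>n. b n + (norm (x - z n))\<^sup>2 / 2 < m + 1 / real (Suc n)"
    by metis
  \<comment> \<open>The midpoint competes for \<open>m\<close>: its value is at most
    \<open>m\<close> plus the mean of the two excesses minus an eighth of the squared distance,
    whence the factor 4.\<close>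
  have gap: "(norm (z n - z k))\<^sup>2 \<le> 4 * (1 / real (Suc n)) + 4 * (1 / real (Suc k))" for n k
  proof -
    define w where "w = (1/2) *\<^sub>R z n + (1/2) *\<^sub>R z k"
    have "w \<in> S"
      using cvx z unfolding w_def ereal_convex_on_def by (auto intro: convexD)
    moreover have "\<phi> w \<le> ereal (1/2 * b n + 1/2 * b k)"
      unfolding w_def using z b by (intro ereal_convex_onD[OF cvx]) auto
    ultimately obtain c where c: "\<phi> w = ereal c" "c \<le> 1/2 * b n + 1/2 * b k"
      using proper_on_real[OF proper] by metis
    have "m \<le> c + (norm (x - w))\<^sup>2 / 2"
      using m_le[OF \<open>w \<in> S\<close> c(1)] .
    then show ?thesis
      using c(2) zb[of n] zb[of k] unfolding w_def half_sum_norm_sq by linarith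
  qed
  have "Cauchy z"
  proof (rule metric_CauchyI)
    fix e :: real assume e: "e > 0"
    obtain N where N: "1 / real (Suc N) < e\<^sup>2 / 8"
      using nat_approx_posE[of "e\<^sup>2 / 8"] e by auto
    have "dist (z n) (z k) < e" if "n \<ge> N" "k \<ge> N" for n k
    proof -
      have "1 / real (Suc n) \<le> 1 / real (Suc N)" "1 / real (Suc k) \<le> 1 / real (Suc N)"
        using that by (auto simp: divide_simps)
      then have "(norm (z n - z k))\<^sup>2 < e\<^sup>2"
        using gap[of n k] N by linarith
      then show ?thesis
        using e by (simp add: dist_norm power2_less_imp_less)
    qed
    then show "\<exists>N. \<forall>n\<ge>N. \<forall>k\<ge>N. dist (z n) (z k) < e"
      by blast
  qed
  then obtain u where u: "z \<longlonglongrightarrow> u"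
    using Cauchy_convergent_iff convergent_def by blast
  have uS: "u \<in> S"
    using cl u z closed_sequentially by metis
  have "\<phi> u \<le> ereal (m - (norm (x - u))\<^sup>2 / 2)"
  proof (rule lsc_on_lim_le[OF lsc uS z u])
    show "\<phi> (z n) \<le> ereal (m + 1 / real (Suc n) - (norm (x - z n))\<^sup>2 / 2)" for n
      using zb[of n] by (simp add: b)
    have "(\<lambda>n. m + 1 / real (Suc n) - (norm (x - z n))\<^sup>2 / 2) \<longlonglongrightarrow> m + 0 - (norm (x - u))\<^sup>2 / 2"
      by (intro tendsto_intros u filterlim_compose[OF lim_1_over_n filterlim_Suc])
        simp
    then show "(\<lambda>n. ereal (m + 1 / real (Suc n) - (norm (x - z n))\<^sup>2 / 2))
        \<longlonglongrightarrow> ereal (m - (norm (x - u))\<^sup>2 / 2)"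
      by simp
  qed
  then obtain a where a: "\<phi> u = ereal a" "a \<le> m - (norm (x - u))\<^sup>2 / 2"
    using proper_on_real[OF proper uS] by metis
  show thesis
  proof (rule that[OF uS a(1)])
    fix z b assume "z \<in> S" "\<phi> z = ereal b"
    from m_le[OF this] a(2) show "a + (norm (x - u))\<^sup>2 / 2 \<le> b + (norm (x - z))\<^sup>2 / 2"
      by linarith
  qed
qed

text \<open>First-order optimality: minimality of \<open>u\<close> against
  \<open>(1 - t) *\<^sub>R u + t *\<^sub>R z\<close> is divided by \<open>t\<close>; the surplus,
  \<open>t\<close> times half a squared norm, vanishes along \<open>t = 1 / (n + 1)\<close>.\<close>

lemma proximal_point_variational:
  fixes x u z :: "'b::real_inner"
  assumes proper: "proper_on S \<phi>" and cvx: "ereal_convex_on S \<phi>"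
    and u: "u \<in> S" "\<phi> u = ereal a"
    and min: "\<And>z b. z \<in> S \<Longrightarrow> \<phi> z = ereal b \<Longrightarrow> a + (norm (x - u))\<^sup>2 / 2 \<le> b + (norm (x - z))\<^sup>2 / 2"
    and z: "z \<in> S" "\<phi> z = ereal b"
  shows "(x - u) \<bullet> (z - u) \<le> b - a"
proof -
  have "(x - u) \<bullet> (z - u) \<le> b - a + 1 / real (Suc n) * (norm (z - u))\<^sup>2 / 2" for n
  proof -
    define t where "t = 1 / real (Suc n)"
    have t: "0 < t" "t \<le> 1"
      by (auto simp: t_def)
    define w where "w = (1 - t) *\<^sub>R u + t *\<^sub>R z"
    have "w \<in> S"
      using cvx u z t unfolding w_def ereal_convex_on_def by (auto intro: convexD)
    moreover have "\<phi> w \<le> ereal ((1 - t) * a + t * b)"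
      unfolding w_def using u z t by (intro ereal_convex_onD[OF cvx]) auto
    ultimately obtain c where c: "\<phi> w = ereal c" "c \<le> (1 - t) * a + t * b"
      using proper_on_real[OF proper] by metis
    have eq: "x - w = (x - u) - t *\<^sub>R (z - u)"
      by (simp add: w_def algebra_simps)
    have "(norm (x - w))\<^sup>2 = (norm (x - u))\<^sup>2 - 2 * t * ((x - u) \<bullet> (z - u)) + t * (t * (norm (z - u))\<^sup>2)"
      unfolding eq by (simp only: power2_norm_eq_inner inner_diff_left inner_diff_right
          inner_scaleR_left inner_scaleR_right inner_commute)
    then have "t * ((x - u) \<bullet> (z - u)) \<le> (1 - t) * a + t * b - a + t * (t * (norm (z - u))\<^sup>2) / 2"
      using min[OF \<open>w \<in> S\<close> c(1)] c(2) by linarith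
    also have "\<dots> = t * (b - a + t * (norm (z - u))\<^sup>2 / 2)"
      by (simp add: algebra_simps)
    finally have "t * ((x - u) \<bullet> (z - u)) \<le> t * (b - a + t * (norm (z - u))\<^sup>2 / 2)" .
    then show ?thesis
      using t unfolding t_def[symmetric] by simp
  qed
  moreover have "(\<lambda>n. b - a + 1 / real (Suc n) * (norm (z - u))\<^sup>2 / 2) \<longlonglongrightarrow> b - a + 0 * (norm (z - u))\<^sup>2 / 2"
    by (intro tendsto_intros filterlim_compose[OF lim_1_over_n filterlim_Suc]) simp
  ultimately show ?thesis
    by (intro LIMSEQ_le_const[where x = "b - a"]) auto
qed

text \<open>\<open>prox_on\<close> is a choice among minimizers, so existence must be known before
  the chosen point can be used; its minimality then gives the inequality.\<close>

lemma prox_on_characterization: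
  fixes S :: "'b::{real_inner, complete_space} set"
  assumes cl: "closed S" and proper: "proper_on S \<phi>" and cvx: "ereal_convex_on S \<phi>"
    and lsc: "lsc_on S \<phi>"
  obtains a where "prox_on S \<phi> x \<in> S" "\<phi> (prox_on S \<phi> x) = ereal a"
    "\<And>z b. z \<in> S \<Longrightarrow> \<phi> z = ereal b \<Longrightarrow> (x - prox_on S \<phi> x) \<bullet> (z - prox_on S \<phi> x) \<le> b - a"
proof -
  define J where "J = (\<lambda>z. \<phi> z + ereal (1 / 2 * (norm (x - z))\<^sup>2))"
  define u where "u = prox_on S \<phi> x"
  obtain v c where v: "v \<in> S" "\<phi> v = ereal c"
    "\<And>z b. z \<in> S \<Longrightarrow> \<phi> z = ereal b \<Longrightarrow> c + (norm (x - v))\<^sup>2 / 2 \<le> b + (norm (x - z))\<^sup>2 / 2"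
    using proximal_point_exists[OF assms] by blast
  have "J v \<le> J z" if "z \<in> S" for z
  proof (cases "\<phi> z")
    case (real b)
    then show ?thesis
      using v(3)[OF that real] v(2) by (simp add: J_def)
  qed (use that proper in \<open>auto simp: J_def proper_on_def\<close>)
  then have "is_arg_min J (\<lambda>z. z \<in> S) v"
    using v(1) by (auto simp: is_arg_min_def not_less)
  then have "is_arg_min J (\<lambda>z. z \<in> S) u"
    unfolding u_def prox_on_def arg_min_on_def arg_min_def J_def[symmetric] by (rule someI)
  then have u: "u \<in> S" "\<And>z. z \<in> S \<Longrightarrow> J u \<le> J z"
    by (auto simp: is_arg_min_def not_less)
  have "\<phi> u \<noteq> \<infinity>"
    using u(2)[OF v(1)] v(2) by (auto simp: J_def)
  then obtain a where a: "\<phi> u = ereal a"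
    using proper u(1) by (cases "\<phi> u") (auto simp: proper_on_def)
  have "a + (norm (x - u))\<^sup>2 / 2 \<le> b + (norm (x - z))\<^sup>2 / 2" if "z \<in> S" "\<phi> z = ereal b" for z b
    using u(2)[OF that(1)] a that(2) by (simp add: J_def)
  from proximal_point_variational[OF proper cvx u(1) a this] show thesis
    using that u(1) a unfolding u_def by blast
qed

section \<open>Projections, weak closedness and Riesz representation via proximal points\<close>

lemma lsc_on_continuous_on:
  fixes g :: "'b::metric_space \<Rightarrow> real"
  assumes "continuous_on S g"
  shows "lsc_on S (\<lambda>x. ereal (g x))"
  unfolding lsc_on_def
proof
  fix x assume "x \<in> S"
  then have *: "((\<lambda>y. ereal (g y)) \<longlongrightarrow> ereal (g x)) (at x within S)"
    using assms by (simp add: continuous_on_def)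
  show "ereal (g x) \<le> Liminf (at x within S) (\<lambda>x. ereal (g x))"
    unfolding le_Liminf_iff using order_tendstoD(1)[OF *] by blast
qed

text \<open>The constraint set is part of \<open>prox_on\<close>, so the projection is the proximal
  point of the zero function on \<open>C\<close>.\<close>

lemma closed_convex_projection:
  fixes C :: "'b::{real_inner, complete_space} set"
  assumes "closed C" "convex C" "C \<noteq> {}"
  obtains u where "u \<in> C" "\<And>z. z \<in> C \<Longrightarrow> (x - u) \<bullet> (z - u) \<le> 0"
proof -
  have "proper_on C (\<lambda>_. ereal 0)" "ereal_convex_on C (\<lambda>_. ereal 0)" "lsc_on C (\<lambda>_. ereal 0)"
    using assms lsc_on_continuous_on[of C "\<lambda>_. 0"]
    by (auto simp: proper_on_def ereal_convex_on_def zero_ereal_def)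
  from prox_on_characterization[OF assms(1) this, of x] show thesis
    using that by (metis diff_self ereal.inject)
qed

text \<open>The projection \<open>u\<close> of \<open>l\<close> satisfies a linear inequality at
  every \<open>X n\<close> in \<open>C\<close>; weak convergence carries it to \<open>l\<close>,
  where it says that the squared norm of \<open>l - u\<close> is at most 0.\<close>

lemma weak_limit_in_closed_convex:
  fixes C :: "'b::{real_inner, complete_space} set"
  assumes C: "closed C" "convex C" and X: "eventually (\<lambda>n. X n \<in> C) sequentially"
    and lim: "\<And>y. (\<lambda>n. X n \<bullet> y) \<longlonglongrightarrow> l \<bullet> y"
  shows "l \<in> C"
proof -
  have "C \<noteq> {}"
    using eventually_happens[OF X] by auto
  then obtain u where u: "u \<in> C" "\<And>z. z \<in> C \<Longrightarrow> (l - u) \<bullet> (z - u) \<le> 0"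
    using closed_convex_projection[OF C] by metis
  have "(\<lambda>n. X n \<bullet> (l - u) - u \<bullet> (l - u)) \<longlonglongrightarrow> l \<bullet> (l - u) - u \<bullet> (l - u)"
    by (intro tendsto_intros lim)
  moreover have "eventually (\<lambda>n. X n \<bullet> (l - u) - u \<bullet> (l - u) \<le> 0) sequentially"
    using X by eventually_elim (use u(2) in \<open>metis inner_commute inner_diff_left\<close>)
  ultimately have "l \<bullet> (l - u) - u \<bullet> (l - u) \<le> 0"
    using tendsto_upperbound by (metis trivial_limit_sequentially)
  then have "(l - u) \<bullet> (l - u) \<le> 0"
    by (simp add: inner_diff_left)
  then have "l = u"
    by (metis eq_iff_diff_eq_0 inner_ge_zero inner_eq_zero_iff order_antisym)
  with u(1) show ?thesis
    by simp
qed

text \<open>The representing vector minimizes half the squared norm minus \<open>L\<close> on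
  \<open>S\<close>, so it is the proximal point of \<open>- L\<close> at 0. Testing its inequality
  at \<open>u + v\<close> and \<open>u - v\<close> yields both directions.\<close>

lemma riesz_representation_on:
  fixes S :: "'b::{real_inner, complete_space} set"
  assumes S: "subspace S" "closed S" and L: "bounded_linear L"
  obtains g where "g \<in> S" "\<And>v. v \<in> S \<Longrightarrow> L v = g \<bullet> v"
proof -
  interpret L: bounded_linear L by fact
  define \<phi> where "\<phi> = (\<lambda>v. ereal (- L v))"
  have "proper_on S \<phi>"
    using subspace_0[OF S(1)] by (auto simp: proper_on_def \<phi>_def)
  moreover have "ereal_convex_on S \<phi>"
    using subspace_imp_convex[OF S(1)]
    by (auto simp: ereal_convex_on_def \<phi>_def L.add L.scaleR)
  moreover have "lsc_on S \<phi>"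
    unfolding \<phi>_def by (intro lsc_on_continuous_on continuous_intros
        linear_continuous_on[OF L])
  ultimately obtain a where a: "prox_on S \<phi> 0 \<in> S" "\<phi> (prox_on S \<phi> 0) = ereal a"
    "\<And>z b. z \<in> S \<Longrightarrow> \<phi> z = ereal b \<Longrightarrow> (0 - prox_on S \<phi> 0) \<bullet> (z - prox_on S \<phi> 0) \<le> b - a"
    using prox_on_characterization[OF S(2)] by blast
  define u where "u = prox_on S \<phi> 0"
  have le: "L v \<le> u \<bullet> v" if "v \<in> S" for v
  proof -
    have "u + v \<in> S"
      using subspace_add[OF S(1)] a(1) that unfolding u_def by blast
    from a(3)[OF this, of "- L (u + v)"] a(2) show ?thesis
      unfolding u_def[symmetric] by (auto simp: \<phi>_def L.add)
  qed
  have "L v = u \<bullet> v" if "v \<in> S" for v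
    using le[OF that] le[OF subspace_neg[OF S(1) that]] by (simp add: linear_neg[OF bounded_linear.linear[OF L]])
  then show thesis
    using that a(1) unfolding u_def by blast
qed

section \<open>Gradients of functions on a closed subspace\<close>

lemma has_derivative_on_line:
  assumes S: "subspace S" and f: "(f has_derivative f') (at x within S)" and x: "x \<in> S" "v \<in> S"
  shows "((\<lambda>t. f (x + t *\<^sub>R v)) has_field_derivative f' v) (at 0)"
proof -
  have "((\<lambda>t. x + t *\<^sub>R v) has_derivative (\<lambda>t. t *\<^sub>R v)) (at 0)"
    by (auto intro!: derivative_eq_intros)
  moreover have "(\<lambda>t. x + t *\<^sub>R v) ` UNIV \<subseteq> S"
    using S x by (auto intro: subspace_add subspace_scale)
  then have "(f has_derivative f') (at (x + 0 *\<^sub>R v) within (\<lambda>t. x + t *\<^sub>R v) ` UNIV)"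
    using f has_derivative_subset by auto
  ultimately have "((\<lambda>t. f (x + t *\<^sub>R v)) has_derivative (\<lambda>t. f' (t *\<^sub>R v))) (at 0)"
    using has_derivative_in_compose[of "\<lambda>t. x + t *\<^sub>R v" _ 0 UNIV f f'] by simp
  moreover have "f' (t *\<^sub>R v) = t * f' v" for t
    using has_derivative_linear[OF f] linear_scale by fastforce
  ultimately show ?thesis
    unfolding has_field_derivative_def by (simp add: mult_commute_abs)
qed

text \<open>The definite description in \<open>gradient_on\<close> denotes. Existence: a derivative
  within \<open>S\<close> only sees increments in \<open>S\<close>, so it may be replaced by its
  Riesz representative. Uniqueness: two candidates agree along the line in the direction of their
  difference, which lies in \<open>S\<close>.\<close>

lemma has_derivative_gradient_on:
  fixes S :: "'b::{real_inner, complete_space} set"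
  assumes S: "subspace S" "closed S" and f: "f differentiable (at x within S)" and x: "x \<in> S"
  shows "(f has_derivative (\<lambda>v. gradient_on S f x \<bullet> v)) (at x within S)"
proof -
  obtain f' where f': "(f has_derivative f') (at x within S)"
    using f unfolding differentiable_def by blast
  obtain g where g: "g \<in> S" "\<And>v. v \<in> S \<Longrightarrow> f' v = g \<bullet> v"
    using riesz_representation_on[OF S has_derivative_bounded_linear[OF f']] by blast
  have "(f has_derivative (\<lambda>v. g \<bullet> v)) (at x within S)"
    unfolding has_derivative_within
  proof
    show "bounded_linear (\<lambda>v. g \<bullet> v)"
      by (rule bounded_linear_inner_right)
    have "((\<lambda>y. (1 / norm (y - x)) *\<^sub>R (f y - (f x + f' (y - x)))) \<longlongrightarrow> 0) (at x within S)"
      using f' unfolding has_derivative_within by blast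
    then show "((\<lambda>y. (1 / norm (y - x)) *\<^sub>R (f y - (f x + g \<bullet> (y - x)))) \<longlongrightarrow> 0) (at x within S)"
    proof (rule Lim_transform_eventually)
      show "\<forall>\<^sub>F y in at x within S. (1 / norm (y - x)) *\<^sub>R (f y - (f x + f' (y - x)))
          = (1 / norm (y - x)) *\<^sub>R (f y - (f x + g \<bullet> (y - x)))"
        unfolding eventually_at_filter
        using g(2) subspace_diff[OF S(1) _ x] by (auto intro!: always_eventually)
    qed
  qed
  then have "\<exists>!g. g \<in> S \<and> (f has_derivative (\<lambda>v. g \<bullet> v)) (at x within S)"
  proof (intro ex_ex1I exI[of _ g] conjI g(1))
    fix g1 g2
    assume *: "g1 \<in> S \<and> (f has_derivative (\<lambda>v. g1 \<bullet> v)) (at x within S)"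
      "g2 \<in> S \<and> (f has_derivative (\<lambda>v. g2 \<bullet> v)) (at x within S)"
    then have "g1 - g2 \<in> S"
      using subspace_diff[OF S(1)] by blast
    then have "g1 \<bullet> (g1 - g2) = g2 \<bullet> (g1 - g2)"
      using * has_derivative_on_line[OF S(1) _ x] by (metis DERIV_unique)
    then show "g1 = g2"
      by (metis eq_iff_diff_eq_0 inner_diff_left inner_eq_zero_iff)
  qed
  then show ?thesis
    using theI'[of "\<lambda>g. g \<in> S \<and> (f has_derivative (\<lambda>v. g \<bullet> v)) (at x within S)"]
    unfolding gradient_on_def by blast
qed

text \<open>Restriction to the line through \<open>x\<close> and \<open>z\<close> reduces it to the
  tangent inequality in one real variable, read off at parameter 1.\<close>

lemma convex_on_gradient_inequality:
  fixes S :: "'b::{real_inner, complete_space} set"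
  assumes S: "subspace S" "closed S" and cvx: "convex_on S f"
    and f: "f differentiable (at x within S)" and x: "x \<in> S" and z: "z \<in> S"
  shows "f x + gradient_on S f x \<bullet> (z - x) \<le> f z"
proof -
  have zx: "z - x \<in> S"
    using subspace_diff S x z by blast
  have "convex_on UNIV (\<lambda>t::real. f (x + t *\<^sub>R (z - x)))"
  proof (rule convex_onI)
    fix t a b :: real assume t: "0 < t" "t < 1"
    have "f ((1 - t) *\<^sub>R (x + a *\<^sub>R (z - x)) + t *\<^sub>R (x + b *\<^sub>R (z - x)))
      \<le> (1 - t) * f (x + a *\<^sub>R (z - x)) + t * f (x + b *\<^sub>R (z - x))"
      using t S(1) x zx by (intro convex_onD[OF cvx]) (auto intro!: subspace_add subspace_scale)
    also have "(1 - t) *\<^sub>R (x + a *\<^sub>R (z - x)) + t *\<^sub>R (x + b *\<^sub>R (z - x))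
        = x + ((1 - t) *\<^sub>R a + t *\<^sub>R b) *\<^sub>R (z - x)"
      by (simp add: algebra_simps)
    finally show "f (x + ((1 - t) *\<^sub>R a + t *\<^sub>R b) *\<^sub>R (z - x))
        \<le> (1 - t) * f (x + a *\<^sub>R (z - x)) + t * f (x + b *\<^sub>R (z - x))" .
  qed simp
  from convex_on_imp_above_tangent[OF this _ _ _
      has_derivative_on_line[OF S(1) has_derivative_gradient_on[OF S f x] x zx], of 1]
  show ?thesis
    by simp
qed

section \<open>Multiplication of the penalties by a step size\<close>

lemma proper_on_scale:
  assumes "proper_on S \<phi>" "c > 0"
  shows "proper_on S (\<lambda>z. ereal c * \<phi> z)"
  using assms by (auto simp: proper_on_def ereal_mult_eq_MInfty ereal_mult_eq_PInfty)

lemma ereal_convex_on_scale: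
  assumes proper: "proper_on S \<phi>" and cvx: "ereal_convex_on S \<phi>" and c: "c > 0"
  shows "ereal_convex_on S (\<lambda>z. ereal c * \<phi> z)"
  unfolding ereal_convex_on_def
proof (intro conjI ballI allI impI)
  show "convex S"
    using cvx by (simp add: ereal_convex_on_def)
  fix x y u v assume *: "x \<in> S" "y \<in> S" "(u::real) \<ge> 0" "(v::real) \<ge> 0" "u + v = 1"
  then have "\<phi> (u *\<^sub>R x + v *\<^sub>R y) \<le> ereal u * \<phi> x + ereal v * \<phi> y"
    using cvx unfolding ereal_convex_on_def by blast
  then have "ereal c * \<phi> (u *\<^sub>R x + v *\<^sub>R y) \<le> ereal c * (ereal u * \<phi> x + ereal v * \<phi> y)"
    using c by (intro ereal_mult_left_mono) auto
  \<comment> \<open>Distributivity in \<open>ereal\<close> can fail when infinities of opposite sign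
    meet; properness rules out \<open>- \<infinity>\<close>.\<close>
  also have "\<dots> = ereal u * (ereal c * \<phi> x) + ereal v * (ereal c * \<phi> y)"
  proof -
    have "\<phi> x \<noteq> - \<infinity>" "\<phi> y \<noteq> - \<infinity>"
      using proper * by (auto simp: proper_on_def)
    then show ?thesis
      using c * by (cases "\<phi> x"; cases "\<phi> y"; cases "u = 0"; cases "v = 0") (auto simp: algebra_simps)
  qed
  finally show "ereal c * \<phi> (u *\<^sub>R x + v *\<^sub>R y) \<le> ereal u * (ereal c * \<phi> x) + ereal v * (ereal c * \<phi> y)" .
qed

lemma lsc_on_scale:
  assumes lsc: "lsc_on S \<phi>" and c: "c > 0"
  shows "lsc_on S (\<lambda>z. ereal c * \<phi> z)"
  unfolding lsc_on_def
proof
  fix x assume x: "x \<in> S"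
  show "ereal c * \<phi> x \<le> Liminf (at x within S) (\<lambda>z. ereal c * \<phi> z)"
  proof (cases "at x within S = bot")
    case False
    then show ?thesis
      using lsc x c by (subst Liminf_ereal_mult_left) (auto simp: lsc_on_def intro!: ereal_mult_left_mono)
  qed simp
qed

section \<open>Weak convergence\<close>

text \<open>A diagonal subsequence converges against a countable dense set of test vectors,
  boundedness extends this to all \<open>y\<close>, and the limit functional, being bounded, has a
  Riesz representative.\<close>

lemma weakly_convergent_subsequence:
  fixes X :: "nat \<Rightarrow> 'b::{real_inner, complete_space, second_countable_topology}"
  assumes bd: "\<And>n. norm (X n) \<le> B"
  obtains r l where "strict_mono (r :: nat \<Rightarrow> nat)" "\<And>y. (\<lambda>n. X (r n) \<bullet> y) \<longlonglongrightarrow> l \<bullet> y"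
proof -
  obtain D :: "'b set" where D: "countable D" "\<And>U. open U \<Longrightarrow> U \<noteq> {} \<Longrightarrow> \<exists>d\<in>D. d \<in> U"
    by (rule countable_dense_setE) blast
  have B: "B \<ge> 0"
    using order_trans[OF norm_ge_zero bd] .
  \<comment> \<open>The diagonal extraction requires one bound for all test vectors, hence the
    normalized \<open>sgn d\<close> instead of \<open>d\<close>.\<close>
  have "norm (X n \<bullet> sgn d) \<le> B" for n d
  proof -
    have "\<bar>X n \<bullet> sgn d\<bar> \<le> norm (X n) * norm (sgn d)"
      by (rule Cauchy_Schwarz_ineq2)
    also have "\<dots> \<le> B * 1"
      using bd B by (intro mult_mono) (auto simp: norm_sgn)
    finally show ?thesis
      by simp
  qed
  then obtain r where r: "strict_mono (r :: nat \<Rightarrow> nat)"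
    "\<And>d. d \<in> D \<Longrightarrow> \<exists>l. (\<lambda>n. X (r n) \<bullet> sgn d) \<longlonglongrightarrow> l"
    using function_convergent_subsequence[OF D(1), of "\<lambda>n d. X n \<bullet> sgn d" B] by metis
  have convD: "convergent (\<lambda>n. X (r n) \<bullet> d)" if d: "d \<in> D" for d
  proof -
    obtain l where "(\<lambda>n. X (r n) \<bullet> sgn d) \<longlonglongrightarrow> l"
      using r(2)[OF d] by blast
    then have "(\<lambda>n. norm d * (X (r n) \<bullet> sgn d)) \<longlonglongrightarrow> norm d * l"
      by (intro tendsto_intros)
    moreover have "norm d * (X (r n) \<bullet> sgn d) = X (r n) \<bullet> d" for n
      by (cases "d = 0") (auto simp: sgn_div_norm)
    ultimately show ?thesis
      by (auto simp: convergent_def)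
  qed
  have conv: "convergent (\<lambda>n. X (r n) \<bullet> y)" for y
  proof -
    have "Cauchy (\<lambda>n. X (r n) \<bullet> y)"
    proof (rule metric_CauchyI)
      fix e :: real assume e: "e > 0"
      \<comment> \<open>\<open>B + 1\<close> in place of \<open>B\<close> avoids a division by zero
        when \<open>B\<close> is 0.\<close>
      define \<delta> where "\<delta> = e / (4 * (B + 1))"
      have "\<delta> > 0"
        using e B by (simp add: \<delta>_def)
      then obtain d where d: "d \<in> D" "dist y d < \<delta>"
        using D(2)[of "ball y \<delta>"] by auto
      obtain N where N: "\<And>m n. m \<ge> N \<Longrightarrow> n \<ge> N \<Longrightarrow> dist (X (r m) \<bullet> d) (X (r n) \<bullet> d) < e / 2"
        using metric_CauchyD[OF convergent_Cauchy[OF convD[OF d(1)]], of "e / 2"] e by auto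
      have close: "\<bar>X (r m) \<bullet> y - X (r m) \<bullet> d\<bar> \<le> e / 4" for m
      proof -
        have "\<bar>X (r m) \<bullet> (y - d)\<bar> \<le> norm (X (r m)) * norm (y - d)"
          by (rule Cauchy_Schwarz_ineq2)
        also have "\<dots> \<le> (B + 1) * \<delta>"
          using bd[of "r m"] d(2) B by (intro mult_mono) (auto simp: dist_norm)
        also have "\<dots> = e / 4"
          using B by (simp add: \<delta>_def divide_simps)
        finally show ?thesis
          by (simp add: inner_diff_right)
      qed
      have "dist (X (r m) \<bullet> y) (X (r n) \<bullet> y) < e" if "m \<ge> N" "n \<ge> N" for m n
        using close[of m] close[of n] N[OF that] unfolding dist_real_def by linarith
      then show "\<exists>N. \<forall>m\<ge>N. \<forall>n\<ge>N. dist (X (r m) \<bullet> y) (X (r n) \<bullet> y) < e"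
        by blast
    qed
    then show ?thesis
      by (rule Cauchy_convergent)
  qed
  define L where "L y = lim (\<lambda>n. X (r n) \<bullet> y)" for y
  have L: "(\<lambda>n. X (r n) \<bullet> y) \<longlonglongrightarrow> L y" for y
    using conv[of y] unfolding L_def convergent_LIMSEQ_iff .
  have "bounded_linear L"
  proof (rule bounded_linear_intro)
    show "L (a + b) = L a + L b" for a b
      using tendsto_add[OF L[of a] L[of b]] L[of "a + b"]
      by (intro LIMSEQ_unique[of "\<lambda>n. X (r n) \<bullet> (a + b)"]) (auto simp: inner_add_right)
    show "L (c *\<^sub>R a) = c *\<^sub>R L a" for c a
      using tendsto_mult[OF tendsto_const L[of a], of c] L[of "c *\<^sub>R a"]
      by (intro LIMSEQ_unique[of "\<lambda>n. X (r n) \<bullet> (c *\<^sub>R a)"]) auto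
    show "norm (L a) \<le> norm a * B" for a
    proof -
      have "\<bar>X (r n) \<bullet> a\<bar> \<le> norm a * B" for n
        using Cauchy_Schwarz_ineq2[of "X (r n)" a] mult_right_mono[OF bd[of "r n"], of "norm a"]
        by (simp add: mult.commute)
      then show ?thesis
        using tendsto_rabs[OF L[of a]] by (auto intro!: LIMSEQ_le_const2)
    qed
  qed
  then obtain l where "\<And>v. L v = l \<bullet> v"
    using riesz_representation_on[OF subspace_UNIV closed_UNIV] by (metis UNIV_I)
  then show thesis
    using that[OF r(1), of l] L by simp
qed

text \<open>Opial's lemma for the inner product \<open>(x, y) \<mapsto> x \<bullet> W y\<close>.\<close>

lemma opial:
  fixes X :: "nat \<Rightarrow> 'b::{real_inner, complete_space, second_countable_topology}"
  assumes bd: "\<And>n. norm (X n) \<le> B"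
    and W: "linear W" "\<And>x y. x \<bullet> W y = W x \<bullet> y" "\<And>x. x \<bullet> W x = 0 \<Longrightarrow> x = 0"
    and conv: "\<And>z. z \<in> S \<Longrightarrow> convergent (\<lambda>n. (X n - z) \<bullet> W (X n - z))"
    and cluster: "\<And>r l. strict_mono (r :: nat \<Rightarrow> nat) \<Longrightarrow> (\<And>y. (\<lambda>n. X (r n) \<bullet> y) \<longlonglongrightarrow> l \<bullet> y) \<Longrightarrow> l \<in> S"
  obtains l where "l \<in> S" "\<And>y. (\<lambda>n. X n \<bullet> y) \<longlonglongrightarrow> l \<bullet> y"
proof -
  have unique: "z1 = z2"
    if r1: "strict_mono (r1 :: nat \<Rightarrow> nat)" "\<And>y. (\<lambda>n. X (r1 n) \<bullet> y) \<longlonglongrightarrow> z1 \<bullet> y"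
      and r2: "strict_mono (r2 :: nat \<Rightarrow> nat)" "\<And>y. (\<lambda>n. X (r2 n) \<bullet> y) \<longlonglongrightarrow> z2 \<bullet> y"
    for r1 r2 z1 z2
  proof -
    have z: "z1 \<in> S" "z2 \<in> S"
      using cluster r1 r2 by blast+
    \<comment> \<open>Polarization: the difference of the two squared \<open>W\<close>-distances is
      affine in \<open>X n\<close>, so \<open>X n \<bullet> W (z1 - z2)\<close> converges along the
      whole sequence and has the same limit along both subsequences.\<close>
    have eq: "X n \<bullet> W (z1 - z2) = ((X n - z2) \<bullet> W (X n - z2) - (X n - z1) \<bullet> W (X n - z1)
        + z1 \<bullet> W z1 - z2 \<bullet> W z2) / 2" for n
    proof -
      have "z1 \<bullet> W (X n) = X n \<bullet> W z1" "z2 \<bullet> W (X n) = X n \<bullet> W z2"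
        by (metis W(2) inner_commute)+
      then show ?thesis
        by (simp add: linear_diff[OF W(1)] inner_diff_left inner_diff_right)
    qed
    obtain c1 c2 where "(\<lambda>n. (X n - z1) \<bullet> W (X n - z1)) \<longlonglongrightarrow> c1"
      "(\<lambda>n. (X n - z2) \<bullet> W (X n - z2)) \<longlonglongrightarrow> c2"
      using conv z unfolding convergent_def by blast
    then have "(\<lambda>n. X n \<bullet> W (z1 - z2)) \<longlonglongrightarrow> (c2 - c1 + z1 \<bullet> W z1 - z2 \<bullet> W z2) / 2"
      unfolding eq by (intro tendsto_intros) auto
    then obtain c where c: "(\<lambda>n. X n \<bullet> W (z1 - z2)) \<longlonglongrightarrow> c" ..
    have "z1 \<bullet> W (z1 - z2) = c"
      using LIMSEQ_subseq_LIMSEQ[OF c r1(1)] r1(2) by (auto simp: o_def intro: LIMSEQ_unique)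
    moreover have "z2 \<bullet> W (z1 - z2) = c"
      using LIMSEQ_subseq_LIMSEQ[OF c r2(1)] r2(2) by (auto simp: o_def intro: LIMSEQ_unique)
    ultimately have "(z1 - z2) \<bullet> W (z1 - z2) = 0"
      by (simp add: inner_diff_left)
    then show ?thesis
      using W(3) by fastforce
  qed
  obtain r l where r: "strict_mono (r :: nat \<Rightarrow> nat)" "\<And>y. (\<lambda>n. X (r n) \<bullet> y) \<longlonglongrightarrow> l \<bullet> y"
    using weakly_convergent_subsequence[of X B, OF bd] by blast
  have "(\<lambda>n. X n \<bullet> y) \<longlonglongrightarrow> l \<bullet> y" for y
  proof (rule ccontr)
    assume "\<not> ?thesis"
    then obtain e where e: "e > 0" "\<And>N. \<exists>n\<ge>N. dist (X n \<bullet> y) (l \<bullet> y) \<ge> e"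
      unfolding lim_sequentially by (meson not_less)
    then have "infinite {n. dist (X n \<bullet> y) (l \<bullet> y) \<ge> e}"
      unfolding infinite_nat_iff_unbounded_le by blast
    then obtain s where s: "strict_mono (s :: nat \<Rightarrow> nat)" "\<And>n. dist (X (s n) \<bullet> y) (l \<bullet> y) \<ge> e"
      using infinite_enumerate by blast
    obtain s' l' where s': "strict_mono (s' :: nat \<Rightarrow> nat)"
      "\<And>y. (\<lambda>n. X (s (s' n)) \<bullet> y) \<longlonglongrightarrow> l' \<bullet> y"
      using weakly_convergent_subsequence[of "\<lambda>n. X (s n)" B, OF bd] by blast
    have "l' = l"
    proof (rule unique)
      show "strict_mono (s \<circ> s')"
        by (rule strict_mono_o[OF s(1) s'(1)])
      show "(\<lambda>n. X ((s \<circ> s') n) \<bullet> y) \<longlonglongrightarrow> l' \<bullet> y" for y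
        unfolding o_apply by (rule s'(2))
    qed (fact r)+
    then have "(\<lambda>n. dist (X (s (s' n)) \<bullet> y) (l \<bullet> y)) \<longlonglongrightarrow> 0"
      using s'(2)[of y] by (simp add: tendsto_dist_iff[symmetric])
    then have "e \<le> 0"
      using s(2) by (intro LIMSEQ_le_const) auto
    with e(1) show False
      by simp
  qed
  with cluster[OF r] show thesis
    using that by blast
qed

text \<open>Pettis measurability in a separable space: membership in a closed ball amounts to
  countably many inequalities between inner products, and every open set is a countable union of
  closed balls.\<close>

lemma borel_measurable_weakly:
  fixes g :: "'w \<Rightarrow> 'b::{real_inner, second_countable_topology}"
  assumes g[measurable]: "\<And>y. (\<lambda>\<omega>. g \<omega> \<bullet> y) \<in> borel_measurable M"
  shows "g \<in> borel_measurable M"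
proof (rule borel_measurableI)
  fix U :: "'b set" assume U: "open U"
  obtain D :: "'b set" where D: "countable D" "\<And>U. open U \<Longrightarrow> U \<noteq> {} \<Longrightarrow> \<exists>d\<in>D. d \<in> U"
    by (rule countable_dense_setE) blast
  have norm_le: "norm v \<le> r \<longleftrightarrow> (\<forall>d\<in>D. v \<bullet> d \<le> r * norm d)" if "r > 0" for v :: 'b and r
  proof
    assume "norm v \<le> r"
    then show "\<forall>d\<in>D. v \<bullet> d \<le> r * norm d"
      using norm_cauchy_schwarz order_trans mult_right_mono norm_ge_zero by metis
  next
    assume *: "\<forall>d\<in>D. v \<bullet> d \<le> r * norm d"
    have "closed {y. v \<bullet> y \<le> r * norm y}"
      by (intro closed_Collect_le continuous_intros)
    then have "open (- {y. v \<bullet> y \<le> r * norm y})"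
      by (rule open_Compl)
    then have "v \<bullet> v \<le> r * norm v"
      using D(2)[of "- {y. v \<bullet> y \<le> r * norm y}"] * by blast
    then show "norm v \<le> r"
      using that by (cases "v = 0") (auto simp: power2_norm_eq_inner[symmetric] power2_eq_square)
  qed
  have ball: "g -` cball c r \<inter> space M \<in> sets M" if "r > 0" for c r
  proof -
    have "g -` cball c r \<inter> space M = {\<omega> \<in> space M. \<forall>d\<in>D. g \<omega> \<bullet> d - c \<bullet> d \<le> r * norm d}"
      unfolding inner_diff_left[symmetric] norm_le[OF that, symmetric]
      by (auto simp: dist_norm norm_minus_commute)
    also have "\<dots> \<in> sets M"
      using D(1) by measurable
    finally show ?thesis .
  qed
  define I where "I = {(c, q). c \<in> D \<and> q \<in> \<rat> \<and> q > 0 \<and> cball c q \<subseteq> U}"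
  have "countable I"
    by (rule countable_subset[of _ "D \<times> \<rat>"]) (auto simp: I_def D(1) countable_rat)
  have "U \<subseteq> (\<Union>(c, q)\<in>I. cball c q)"
  proof
    fix u assume "u \<in> U"
    then obtain e where e: "e > 0" "ball u e \<subseteq> U"
      using U open_contains_ball by blast
    obtain q where q: "q \<in> \<rat>" "0 < q" "q < e / 2"
      using Rats_dense_in_real[of 0 "e / 2"] e(1) by auto
    obtain c where c: "c \<in> D" "dist u c < q"
      using D(2)[of "ball u q"] q(2) by auto
    have "cball c q \<subseteq> ball u e"
    proof
      fix w assume "w \<in> cball c q"
      then show "w \<in> ball u e"
        using dist_triangle[of u w c] c(2) q(3) by (auto simp: dist_commute)
    qed
    then have "(c, q) \<in> I"
      using e(2) c q by (auto simp: I_def)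
    moreover have "u \<in> cball c q"
      using c(2) by (simp add: dist_commute)
    ultimately show "u \<in> (\<Union>(c, q)\<in>I. cball c q)"
      by blast
  qed
  then have "U = (\<Union>(c, q)\<in>I. cball c q)"
    by (auto simp: I_def)
  then have "g -` U \<inter> space M = (\<Union>(c, q)\<in>I. g -` cball c q \<inter> space M)"
    by auto
  also have "\<dots> \<in> sets M"
    using \<open>countable I\<close> ball by (intro sets.countable_UN') (auto simp: I_def)
  finally show "g -` U \<inter> space M \<in> sets M" .
qed

text \<open>One point is taken from each basic open set that meets \<open>S\<close>. For the set of
  minimizers this leaves only countably many almost sure statements to combine.\<close>

lemma countable_dense_subset:
  fixes S :: "'b::second_countable_topology set"
  obtains T where "countable T" "T \<subseteq> S" "S \<subseteq> closure T"
proof -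
  obtain A :: "'b set set" where A: "countable A" "topological_basis A"
    using ex_countable_basis by auto
  define T where "T = (\<lambda>U. SOME x. x \<in> U \<inter> S) ` {U \<in> A. U \<inter> S \<noteq> {}}"
  have some: "(SOME x. x \<in> U \<inter> S) \<in> U \<inter> S" if "U \<inter> S \<noteq> {}" for U
    using that by (meson all_not_in_conv someI_ex)
  have "S \<subseteq> closure T"
  proof
    fix x assume x: "x \<in> S"
    show "x \<in> closure T"
      unfolding closure_iff_nhds_not_empty
    proof (intro allI impI)
      fix Q R assume "R \<subseteq> Q" "open R" "x \<in> R"
      then obtain U where U: "U \<in> A" "x \<in> U" "U \<subseteq> R"
        using topological_basisE[OF A(2)] by metis
      then show "T \<inter> Q \<noteq> {}"
        using some[of U] x \<open>R \<subseteq> Q\<close> unfolding T_def by blast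
    qed
  qed
  moreover have "countable T" "T \<subseteq> S"
    using A(1) some unfolding T_def by auto
  ultimately show thesis
    using that by blast
qed

text \<open>Boxes of basic open sets form a countable basis, the coordinates being finite in number.
  Weak compactness, Opial's lemma and weak measurability thus apply to the direct sum.\<close>

instance vec :: ("{metric_space, second_countable_topology}", finite) second_countable_topology
proof
  obtain A :: "'a set set" where A: "countable A" "topological_basis A"
    using ex_countable_basis by auto
  define B :: "('a ^ 'b) set set" where "B = (\<lambda>U. {x. \<forall>i. x $ i \<in> U i}) ` (UNIV \<rightarrow>\<^sub>E A)"
  have "countable B"
    unfolding B_def using A(1) by (intro countable_image countable_PiE) auto
  moreover have "topological_basis B"
  proof (rule topological_basisI)
    fix U assume "U \<in> B"
    then show "open U"
      using topological_basis_open[OF A(2)] by (auto simp: B_def intro!: open_vector_box)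
  next
    fix U and x :: "'a ^ 'b" assume "open U" "x \<in> U"
    then obtain Q where Q: "\<And>i. open (Q i) \<and> x $ i \<in> Q i" "\<And>y. (\<forall>i. y $ i \<in> Q i) \<Longrightarrow> y \<in> U"
      unfolding open_vec_def by metis
    have "\<forall>i. \<exists>R. R \<in> A \<and> x $ i \<in> R \<and> R \<subseteq> Q i"
      using topological_basisE[OF A(2)] Q(1) by metis
    then obtain R where R: "\<And>i. R i \<in> A \<and> x $ i \<in> R i \<and> R i \<subseteq> Q i"
      by metis
    have "{y. \<forall>i. y $ i \<in> R i} \<subseteq> U"
    proof
      fix y assume "y \<in> {y. \<forall>i. y $ i \<in> R i}"
      then have "\<forall>i. y $ i \<in> Q i"
        using R by blast
      then show "y \<in> U"
        by (rule Q(2))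
    qed
    with R show "\<exists>B'\<in>B. x \<in> B' \<and> B' \<subseteq> U"
      unfolding B_def by (intro bexI[of _ "{x. \<forall>i. x $ i \<in> R i}"]) auto
  qed
  ultimately show "\<exists>B::('a ^ 'b) set set. countable B \<and> open = generate_topology B"
    using topological_basis_imp_subbasis by blast
qed

text \<open>Near \<open>z\<close> the quadratic is Lipschitz in its centre with a constant
  independent of \<open>n\<close>, so the Cauchy property passes from \<open>T\<close> to its
  closure.\<close>

lemma convergent_quadratic_closure:
  fixes X :: "nat \<Rightarrow> 'b::real_inner"
  assumes bd: "\<And>n. norm (X n) \<le> K" and W: "bounded_linear W" "\<And>x y. x \<bullet> W y = W x \<bullet> y"
    and conv: "\<And>z. z \<in> T \<Longrightarrow> convergent (\<lambda>n. (X n - z) \<bullet> W (X n - z))"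
    and z: "z \<in> closure T"
  shows "convergent (\<lambda>n. (X n - z) \<bullet> W (X n - z))"
proof (rule Cauchy_convergent, rule metric_CauchyI)
  fix e :: real assume e: "e > 0"
  interpret W: bounded_linear W by fact
  obtain C where C: "C > 0" "\<And>x. norm (W x) \<le> norm x * C"
    using W.pos_bounded by blast
  \<comment> \<open>\<open>R\<close> bounds the norm of \<open>(X n - z) + (X n - t)\<close> for
    every \<open>t\<close> within distance 1 of \<open>z\<close>.\<close>
  define R where "R = 2 * K + 2 * norm z + 1"
  have K: "K \<ge> 0"
    using order_trans[OF norm_ge_zero bd] .
  then have R: "R > 0"
    by (simp add: R_def add_nonneg_pos)
  obtain t where t: "t \<in> T" "dist t z < min 1 (e / (4 * (R * C)))"
    using z e C(1) R unfolding closure_approachable by (metis divide_pos_pos min_less_iff_conj mult_pos_pos zero_less_numeral zero_less_one)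
  have tz: "norm (t - z) < 1" "norm (t - z) < e / (4 * (R * C))"
    using t(2) by (auto simp: dist_norm)
  have close: "\<bar>(X n - z) \<bullet> W (X n - z) - (X n - t) \<bullet> W (X n - t)\<bar> \<le> e / 4" for n
  proof -
    have "(X n - z) \<bullet> W (X n - z) - (X n - t) \<bullet> W (X n - t) = (t - z) \<bullet> W ((X n - z) + (X n - t))"
    proof -
      have "u \<bullet> W u - v \<bullet> W v = (u - v) \<bullet> W (u + v)" for u v
      proof -
        have "v \<bullet> W u = u \<bullet> W v"
          using W(2)[of v u] by (simp add: inner_commute)
        then show ?thesis
          by (simp add: W.add inner_add_right inner_diff_left)
      qed
      from this[of "X n - z" "X n - t"] show ?thesis
        by simp
    qed
    also have "\<bar>\<dots>\<bar> \<le> norm (t - z) * norm (W ((X n - z) + (X n - t)))"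
      by (rule Cauchy_Schwarz_ineq2)
    also have "\<dots> \<le> e / (4 * (R * C)) * (R * C)"
    proof (intro mult_mono)
      have "norm ((X n - z) + (X n - t)) \<le> (norm (X n) + norm z) + (norm (X n) + norm t)"
        by (meson add_mono norm_triangle_ineq norm_triangle_ineq4 order_trans)
      also have "norm t \<le> norm z + norm (t - z)"
        using norm_triangle_ineq[of z "t - z"] by simp
      finally have "norm ((X n - z) + (X n - t)) \<le> R"
        using bd[of n] tz(1) unfolding R_def by linarith
      then show "norm (W ((X n - z) + (X n - t))) \<le> R * C"
        using C(2)[of "(X n - z) + (X n - t)"] mult_right_mono[of _ R C] C(1) by (meson less_imp_le order_trans)
    qed (use tz e R C(1) in auto)
    also have "\<dots> = e / 4"
      using R C(1) by simp
    finally show ?thesis .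
  qed
  obtain n0 where n0: "\<And>m n. m \<ge> n0 \<Longrightarrow> n \<ge> n0 \<Longrightarrow>
      dist ((X m - t) \<bullet> W (X m - t)) ((X n - t) \<bullet> W (X n - t)) < e / 2"
    using metric_CauchyD[OF convergent_Cauchy[OF conv[OF t(1)]], of "e / 2"] e by auto
  have "dist ((X m - z) \<bullet> W (X m - z)) ((X n - z) \<bullet> W (X n - z)) < e" if "m \<ge> n0" "n \<ge> n0" for m n
    using close[of m] close[of n] n0[OF that] unfolding dist_real_def by linarith
  then show "\<exists>n0. \<forall>m\<ge>n0. \<forall>n\<ge>n0. dist ((X m - z) \<bullet> W (X m - z)) ((X n - z) \<bullet> W (X n - z)) < e"
    by blast
qed

text \<open>The limits are chosen without regard to measurability. On the null set \<open>Z\<close>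
  they are replaced by \<open>s\<close>, so that \<open>xs\<close> has values in \<open>S\<close>
  everywhere and its inner products are pointwise limits of measurable functions.\<close>

lemma measurable_weak_limit:
  fixes X :: "nat \<Rightarrow> 'w \<Rightarrow> 'b::{real_inner, second_countable_topology}"
  assumes X: "\<And>n y. (\<lambda>\<omega>. X n \<omega> \<bullet> y) \<in> borel_measurable M" and s: "s \<in> S"
    and lim: "AE \<omega> in M. \<exists>l\<in>S. \<forall>y. (\<lambda>n. X n \<omega> \<bullet> y) \<longlonglongrightarrow> l \<bullet> y"
  obtains xs where "xs \<in> borel_measurable M" "\<And>\<omega>. \<omega> \<in> space M \<Longrightarrow> xs \<omega> \<in> S"
    "AE \<omega> in M. \<forall>y. (\<lambda>n. X n \<omega> \<bullet> y) \<longlonglongrightarrow> xs \<omega> \<bullet> y"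
proof -
  obtain Z where Z: "{\<omega> \<in> space M. \<not> (\<exists>l\<in>S. \<forall>y. (\<lambda>n. X n \<omega> \<bullet> y) \<longlonglongrightarrow> l \<bullet> y)} \<subseteq> Z"
    "emeasure M Z = 0" "Z \<in> sets M"
    using AE_E[OF lim] by blast
  have "\<forall>\<omega>\<in>space M - Z. \<exists>l. l \<in> S \<and> (\<forall>y. (\<lambda>n. X n \<omega> \<bullet> y) \<longlonglongrightarrow> l \<bullet> y)"
    using Z(1) by blast
  then obtain l where l: "\<And>\<omega>. \<omega> \<in> space M - Z \<Longrightarrow> l \<omega> \<in> S"
    "\<And>\<omega> y. \<omega> \<in> space M - Z \<Longrightarrow> (\<lambda>n. X n \<omega> \<bullet> y) \<longlonglongrightarrow> l \<omega> \<bullet> y"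
    by metis
  define xs where "xs \<omega> = (if \<omega> \<in> Z then s else l \<omega>)" for \<omega>
  have "xs \<in> borel_measurable M"
  proof (rule borel_measurable_weakly)
    fix y
    show "(\<lambda>\<omega>. xs \<omega> \<bullet> y) \<in> borel_measurable M"
    proof (rule borel_measurable_LIMSEQ_real)
      show "(\<lambda>\<omega>. if \<omega> \<in> Z then s \<bullet> y else X n \<omega> \<bullet> y) \<in> borel_measurable M" for n
        using Z(3) X[of n y] by measurable
      show "(\<lambda>n. if \<omega> \<in> Z then s \<bullet> y else X n \<omega> \<bullet> y) \<longlonglongrightarrow> xs \<omega> \<bullet> y" if "\<omega> \<in> space M" for \<omega>
        using l(2)[of \<omega> y] that by (simp add: xs_def)
    qed
  qed
  moreover have "xs \<omega> \<in> S" if "\<omega> \<in> space M" for \<omega>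
    using l(1)[of \<omega>] that s by (simp add: xs_def)
  moreover have "AE \<omega> in M. \<forall>y. (\<lambda>n. X n \<omega> \<bullet> y) \<longlonglongrightarrow> xs \<omega> \<bullet> y"
  proof (rule AE_I[of _ _ Z])
    show "{\<omega> \<in> space M. \<not> (\<forall>y. (\<lambda>n. X n \<omega> \<bullet> y) \<longlonglongrightarrow> xs \<omega> \<bullet> y)} \<subseteq> Z"
      using l(2) by (auto simp: xs_def)
  qed (use Z in auto)
  ultimately show thesis
    using that by blast
qed

section \<open>Supermartingales driven by independent inputs with finitely many values\<close>

text \<open>If the upper limit exceeded the lower one, two rationals would fit in between. The
  smaller one is positive because \<open>y\<close> is nonnegative, as the upcrossing bound requires
  of its levels.\<close>

lemma convergent_if_no_oscillation:
  fixes y :: "nat \<Rightarrow> real"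
  assumes nonneg: "\<And>n. y n \<ge> 0" and fin: "liminf (\<lambda>n. ereal (y n)) < \<infinity>"
    and osc: "\<And>a b. a \<in> \<rat> \<Longrightarrow> b \<in> \<rat> \<Longrightarrow> 0 < a \<Longrightarrow> a < b \<Longrightarrow>
      \<not> ((\<exists>\<^sub>F n in sequentially. y n < a) \<and> (\<exists>\<^sub>F n in sequentially. b < y n))"
  shows "convergent y"
proof -
  define l where "l = liminf (\<lambda>n. ereal (y n))"
  define u where "u = limsup (\<lambda>n. ereal (y n))"
  have l: "0 \<le> l"
    unfolding l_def by (rule Liminf_bounded) (use nonneg in auto)
  have "u \<le> l"
  proof (rule ccontr)
    assume "\<not> u \<le> l"
    then have "l < u"
      by simp
    then obtain a where a: "l < ereal (real_of_rat a)" "ereal (real_of_rat a) < u"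
      using ereal_dense3 by blast
    obtain b where b: "ereal (real_of_rat a) < ereal (real_of_rat b)" "ereal (real_of_rat b) < u"
      using ereal_dense3[OF a(2)] by blast
    have "\<exists>\<^sub>F n in sequentially. y n < real_of_rat a"
    proof (rule ccontr)
      assume "\<not> ?thesis"
      then have "\<forall>\<^sub>F n in sequentially. ereal (real_of_rat a) \<le> ereal (y n)"
        by (simp add: not_frequently not_less)
      then have "ereal (real_of_rat a) \<le> l"
        unfolding l_def by (rule Liminf_bounded)
      with a(1) show False
        by simp
    qed
    moreover have "\<exists>\<^sub>F n in sequentially. real_of_rat b < y n"
    proof (rule ccontr)
      assume "\<not> ?thesis"
      then have "\<forall>\<^sub>F n in sequentially. ereal (y n) \<le> ereal (real_of_rat b)"
        by (simp add: not_frequently not_less)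
      then have "u \<le> ereal (real_of_rat b)"
        unfolding u_def by (rule Limsup_bounded)
      with b(2) show False
        by simp
    qed
    moreover have "0 < real_of_rat a"
      using l a(1) by (metis ereal_less(2) le_less_trans)
    ultimately show False
      using osc[of "real_of_rat a" "real_of_rat b"] b(1) by auto
  qed
  moreover obtain c where "l = ereal c"
    using l fin unfolding l_def[symmetric] by (cases l) auto
  ultimately have "y \<longlonglongrightarrow> c"
    by (intro limsup_le_liminf_real) (auto simp: l_def u_def)
  then show ?thesis
    by (auto simp: convergent_def)
qed

lemma ereal_expectation_real:
  assumes "integrable M X"
  shows "ereal_expectation M (\<lambda>\<omega>. ereal (X \<omega>)) = ereal (\<integral>\<omega>. X \<omega> \<partial>M)"
proof -
  have "(\<integral>\<^sup>+\<omega>. ennreal (X \<omega>) \<partial>M) \<noteq> \<infinity>" "(\<integral>\<^sup>+\<omega>. ennreal (- X \<omega>) \<partial>M) \<noteq> \<infinity>"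
    using assms by (auto simp: real_integrable_def)
  then show ?thesis
    unfolding ereal_expectation_def real_lebesgue_integral_def[OF assms] uminus_ereal.simps
      e2ennreal_ereal
    by (cases "\<integral>\<^sup>+\<omega>. ennreal (X \<omega>) \<partial>M"; cases "\<integral>\<^sup>+\<omega>. ennreal (- X \<omega>) \<partial>M") (auto simp: enn2ereal_ennreal)
qed

lemma ereal_expectation_cong:
  assumes "\<And>\<omega>. \<omega> \<in> space M \<Longrightarrow> X \<omega> = Y \<omega>"
  shows "ereal_expectation M X = ereal_expectation M Y"
  unfolding ereal_expectation_def using assms by (simp cong: nn_integral_cong)

lemma (in finite_measure) integral_finite_range:
  fixes g :: "'c \<Rightarrow> real"
  assumes X: "X \<in> measurable M (count_space UNIV)" and R: "finite R" "\<And>\<omega>. \<omega> \<in> space M \<Longrightarrow> X \<omega> \<in> R"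
  shows "(\<integral>\<omega>. g (X \<omega>) \<partial>M) = (\<Sum>a\<in>R. g a * measure M (X -` {a} \<inter> space M))"
proof -
  have "(\<integral>\<omega>. g (X \<omega>) \<partial>M) = (\<integral>\<omega>. (\<Sum>a\<in>R. g a * indicator (X -` {a} \<inter> space M) \<omega>) \<partial>M)"
  proof (rule Bochner_Integration.integral_cong)
    fix \<omega> assume \<omega>: "\<omega> \<in> space M"
    then have "g a * indicator (X -` {a} \<inter> space M) \<omega> = (if a = X \<omega> then g a else 0)" for a
      by (auto simp: indicator_def)
    then show "g (X \<omega>) = (\<Sum>a\<in>R. g a * indicator (X -` {a} \<inter> space M) \<omega>)"
      using R \<omega> by simp
  qed simp
  also have "\<dots> = (\<Sum>a\<in>R. \<integral>\<omega>. g a * indicator (X -` {a} \<inter> space M) \<omega> \<partial>M)"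
    by (intro Bochner_Integration.integral_sum integrable_mult_right integrable_real_indicator)
      (auto intro: measurable_sets[OF X] simp: emeasure_eq_measure)
  also have "\<dots> = (\<Sum>a\<in>R. g a * measure M (X -` {a} \<inter> space M))"
    by (simp add: measure_def Int_absorb2)
  finally show ?thesis .
qed

section \<open>Finite histories of independent inputs and their laws\<close>

locale iid_finite = prob_space M for M :: "'w measure" +
  fixes \<xi> :: "nat \<Rightarrow> 'w \<Rightarrow> 'e::finite" and q :: "'e \<Rightarrow> real"
  assumes indep: "indep_vars (\<lambda>_. count_space UNIV) \<xi> UNIV"
    and prob_\<xi>: "\<And>n e. prob (\<xi> n -` {e} \<inter> space M) = q e"
begin

text \<open>The newest input comes first: a step in time is then a list constructor, and iterates
  and betting strategies are defined by primitive recursion on histories.\<close>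

definition hist :: "nat \<Rightarrow> 'w \<Rightarrow> 'e list" where
  "hist n \<omega> = map (\<lambda>k. \<xi> k \<omega>) (rev [0..<n])"

lemma hist_0 [simp]: "hist 0 \<omega> = []"
  and hist_Suc [simp]: "hist (Suc n) \<omega> = \<xi> n \<omega> # hist n \<omega>"
  by (auto simp: hist_def)

lemma measurable_\<xi>: "\<xi> n \<in> measurable M (count_space UNIV)"
  using indep by (auto simp: indep_vars_def)

lemma measurable_hist [measurable]: "hist n \<in> measurable M (count_space UNIV)"
proof -
  have "hist n -` {l} \<inter> space M \<in> sets M" for l
  proof (induction n arbitrary: l)
    case 0
    have "hist 0 -` {l} \<inter> space M = (if l = [] then space M else {})"
      by auto
    then show ?case
      by simp
  next
    case (Suc n)
    have "hist (Suc n) -` {l} \<inter> space M = (if l = [] then {} else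
        (\<xi> n -` {hd l} \<inter> space M) \<inter> (hist n -` {tl l} \<inter> space M))"
      by (cases l) auto
    moreover have "\<xi> n -` {hd l} \<inter> space M \<in> sets M"
      by (rule measurable_sets[OF measurable_\<xi>]) simp
    ultimately show ?case
      using Suc by (simp del: hist_Suc)
  qed
  moreover have "countable (UNIV :: 'e list set)"
    by simp
  ultimately show ?thesis
    by (subst measurable_count_space_eq_countable) auto
qed

lemma borel_measurable_hist: "(\<lambda>\<omega>. g (hist n \<omega>)) \<in> borel_measurable M"
  by (rule measurable_compose[OF measurable_hist]) simp

lemma finite_length: "finite {l :: 'e list. length l = n}"
  using finite_lists_length_eq[of "UNIV :: 'e set" n] by simp

lemma integrable_hist: "integrable M (\<lambda>\<omega>. (g :: 'e list \<Rightarrow> real) (hist n \<omega>))"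
proof (rule integrable_const_bound)
  show "AE \<omega> in M. norm (g (hist n \<omega>)) \<le> Max ((\<lambda>l. norm (g l)) ` {l. length l = n})"
    using finite_length by (intro AE_I2 Max_ge) (auto simp: hist_def)
qed (rule borel_measurable_hist)

lemma integral_hist:
  "(\<integral>\<omega>. (g :: 'e list \<Rightarrow> real) (hist n \<omega>) \<partial>M)
    = (\<Sum>l | length l = n. g l * prob (hist n -` {l} \<inter> space M))"
  by (rule integral_finite_range[OF measurable_hist finite_length]) (simp add: hist_def)

lemma prob_hist:
  "prob (hist n -` {map a (rev [0..<n])} \<inter> space M) = (\<Prod>k<n. q (a k))"
\<comment> \<open>The empty intersection would be \<open>UNIV\<close> rather than
  \<open>space M\<close>, and independence speaks of nonempty index sets.\<close>
proof (cases "n = 0")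
  case True
  then have "hist n -` {map a (rev [0..<n])} \<inter> space M = space M"
    by auto
  with True show ?thesis
    by (simp add: prob_space)
next
  case False
  have "hist n -` {map a (rev [0..<n])} \<inter> space M = (\<Inter>k\<in>{..<n}. \<xi> k -` {a k} \<inter> space M)"
    using False by (auto simp: hist_def)
  also have "prob \<dots> = (\<Prod>k<n. prob (\<xi> k -` {a k} \<inter> space M))"
    using False by (intro indep_varsD[OF indep]) auto
  finally show ?thesis
    by (simp add: prob_\<xi>)
qed

lemma prob_hist_Suc:
  assumes "length l = n"
  shows "prob (hist (Suc n) -` {e # l} \<inter> space M) = q e * prob (hist n -` {l} \<inter> space M)"
proof -
  define a where "a = (\<lambda>k. if k = n then e else rev l ! k)"
  have "map a (rev [0..<n]) = rev (map a [0..<n])"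
    by (simp add: rev_map)
  also have "map a [0..<n] = rev l"
    using assms by (intro nth_equalityI) (auto simp: a_def)
  finally have l: "l = map a (rev [0..<n])"
    by simp
  have "e # l = map a (rev [0..<Suc n])"
    using l by (simp add: a_def)
  then show ?thesis
    using prob_hist[of "Suc n" a] prob_hist[of n a] l by (simp add: a_def)
qed

text \<open>The tower property: the newest input is independent of the past, so conditioning on
  \<open>hist n\<close> means averaging over it with weights \<open>q\<close>.\<close>

lemma integral_hist_Suc:
  "(\<integral>\<omega>. (g :: 'e list \<Rightarrow> real) (hist (Suc n) \<omega>) \<partial>M) = (\<integral>\<omega>. (\<Sum>e\<in>UNIV. q e * g (e # hist n \<omega>)) \<partial>M)"
proof -
  have L: "{l :: 'e list. length l = Suc n} = (\<lambda>(e, l). e # l) ` (UNIV \<times> {l. length l = n})"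
    by (auto simp: length_Suc_conv image_iff)
  have "(\<integral>\<omega>. g (hist (Suc n) \<omega>) \<partial>M)
      = (\<Sum>(e, l)\<in>UNIV \<times> {l. length l = n}. g (e # l) * prob (hist (Suc n) -` {e # l} \<inter> space M))"
    unfolding integral_hist L
    by (subst sum.reindex) (auto simp: inj_on_def case_prod_unfold)
  also have "\<dots> = (\<Sum>(e, l)\<in>UNIV \<times> {l. length l = n}. q e * g (e # l) * prob (hist n -` {l} \<inter> space M))"
    by (intro sum.cong) (auto simp: prob_hist_Suc)
  also have "\<dots> = (\<Sum>l | length l = n. \<Sum>e\<in>UNIV. q e * g (e # l) * prob (hist n -` {l} \<inter> space M))"
    by (subst sum.cartesian_product[symmetric]) (rule sum.swap)
  also have "\<dots> = (\<integral>\<omega>. (\<Sum>e\<in>UNIV. q e * g (e # hist n \<omega>)) \<partial>M)"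
    by (simp add: integral_hist[of "\<lambda>l. \<Sum>e\<in>UNIV. q e * g (e # l)"] sum_distrib_right)
  finally show ?thesis .
qed

lemma q_nonneg: "q e \<ge> 0"
  using prob_\<xi>[of 0 e] by (metis measure_nonneg)

lemma sum_q: "(\<Sum>e\<in>UNIV. q e) = 1"
  using integral_hist_Suc[of "\<lambda>_. 1" 0] by (simp add: prob_space)

section \<open>Almost sure convergence of functionals of the history\<close>

lemma AE_tendsto_0_if_summable_expectation:
  fixes Z :: "'e list \<Rightarrow> real"
  assumes nonneg: "\<And>l. Z l \<ge> 0" and sum: "summable (\<lambda>n. \<integral>\<omega>. Z (hist n \<omega>) \<partial>M)"
  shows "AE \<omega> in M. (\<lambda>n. Z (hist n \<omega>)) \<longlonglongrightarrow> 0"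
proof -
  \<comment> \<open>Tonelli: the series has finite expectation, hence is finite almost surely, and
    its terms tend to 0.\<close>
  have "(\<integral>\<^sup>+\<omega>. (\<Sum>n. ennreal (Z (hist n \<omega>))) \<partial>M) = (\<Sum>n. \<integral>\<^sup>+\<omega>. ennreal (Z (hist n \<omega>)) \<partial>M)"
    by (rule nn_integral_suminf) (rule borel_measurable_hist)
  also have "\<dots> = (\<Sum>n. ennreal (\<integral>\<omega>. Z (hist n \<omega>) \<partial>M))"
    using nonneg by (intro suminf_cong nn_integral_eq_integral integrable_hist) auto
  also have "\<dots> = ennreal (\<Sum>n. \<integral>\<omega>. Z (hist n \<omega>) \<partial>M)"
    using nonneg sum by (intro suminf_ennreal2) auto
  finally have "(\<integral>\<^sup>+\<omega>. (\<Sum>n. ennreal (Z (hist n \<omega>))) \<partial>M) \<noteq> \<infinity>"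
    by simp
  then have "AE \<omega> in M. (\<Sum>n. ennreal (Z (hist n \<omega>))) \<noteq> \<infinity>"
    using borel_measurable_hist[of "\<lambda>l. ennreal (Z l)"]
    by (intro nn_integral_PInf_AE) measurable
  then show ?thesis
  proof eventually_elim
    case (elim \<omega>)
    then have "summable (\<lambda>n. Z (hist n \<omega>))"
      using nonneg by (intro summable_suminf_not_top) auto
    then show ?case
      by (rule summable_LIMSEQ_zero)
  qed
qed

lemma integral_supermartingale_le:
  fixes Y :: "'e list \<Rightarrow> real"
  assumes "\<And>l. (\<Sum>e\<in>UNIV. q e * Y (e # l)) \<le> Y l"
  shows "(\<integral>\<omega>. Y (hist n \<omega>) \<partial>M) \<le> Y []"
proof (induction n)
  case 0
  then show ?case
    by (simp add: prob_space)
next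
  case (Suc n)
  have "(\<integral>\<omega>. Y (hist (Suc n) \<omega>) \<partial>M) \<le> (\<integral>\<omega>. Y (hist n \<omega>) \<partial>M)"
    unfolding integral_hist_Suc
    using integrable_hist[of "\<lambda>l. \<Sum>e\<in>UNIV. q e * Y (e # l)"] integrable_hist[of Y] assms
    by (intro integral_mono) auto
  with Suc show ?case
    by simp
qed

text \<open>\<open>holding\<close> is the betting strategy that starts when \<open>Y\<close> is below \<open>a\<close> and stops when it is
  above \<open>b\<close>; \<open>upcrossings\<close> counts the completed rounds.\<close>

primrec holding :: "('e list \<Rightarrow> real) \<Rightarrow> real \<Rightarrow> real \<Rightarrow> 'e list \<Rightarrow> bool" where
  "holding Y a b [] \<longleftrightarrow> Y [] < a"
| "holding Y a b (e # l) \<longleftrightarrow> (if holding Y a b l then Y (e # l) \<le> b else Y (e # l) < a)"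

primrec upcrossings :: "('e list \<Rightarrow> real) \<Rightarrow> real \<Rightarrow> real \<Rightarrow> 'e list \<Rightarrow> nat" where
  "upcrossings Y a b [] = 0"
| "upcrossings Y a b (e # l) =
    upcrossings Y a b l + (if holding Y a b l \<and> \<not> holding Y a b (e # l) then 1 else 0)"

text \<open>Doob's upcrossing inequality. \<open>\<Phi>\<close> bounds the gain of the strategy from
  below: \<open>b - a\<close> for each completed round plus the value \<open>Y l - a\<close> of an
  open position. Betting on a supermartingale cannot win on average, and nonnegativity of
  \<open>Y\<close> limits the loss in the open round to \<open>a\<close>.\<close>

lemma expected_upcrossings_le:
  fixes Y :: "'e list \<Rightarrow> real"
  assumes nonneg: "\<And>l. Y l \<ge> 0" and super: "\<And>l. (\<Sum>e\<in>UNIV. q e * Y (e # l)) \<le> Y l"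
    and ab: "0 < a" "a < b"
  shows "(\<integral>\<omega>. real (upcrossings Y a b (hist n \<omega>)) \<partial>M) \<le> a / (b - a)"
proof -
  define \<Phi> where "\<Phi> l = (b - a) * real (upcrossings Y a b l) + (if holding Y a b l then Y l - a else 0)"
    for l
  have step: "\<Phi> (e # l) \<le> \<Phi> l + (if holding Y a b l then Y (e # l) - Y l else 0)" for e l
    using ab by (auto simp: \<Phi>_def algebra_simps)
  have "(\<Sum>e\<in>UNIV. q e * \<Phi> (e # l)) \<le> \<Phi> l" for l
  proof -
    have "(\<Sum>e\<in>UNIV. q e * \<Phi> (e # l))
        \<le> (\<Sum>e\<in>UNIV. q e * (\<Phi> l + (if holding Y a b l then Y (e # l) - Y l else 0)))"
      by (intro sum_mono mult_left_mono step q_nonneg)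
    also have "\<dots> = \<Phi> l + (if holding Y a b l then (\<Sum>e\<in>UNIV. q e * Y (e # l)) - Y l else 0)"
      by (simp add: distrib_left right_diff_distrib sum.distrib sum_subtractf sum_q
          sum_distrib_right[symmetric])
    also have "\<dots> \<le> \<Phi> l"
      using super[of l] by simp
    finally show ?thesis .
  qed
  then have "(\<integral>\<omega>. \<Phi> (hist n \<omega>) \<partial>M) \<le> \<Phi> []"
    by (rule integral_supermartingale_le)
  also have "\<Phi> [] \<le> 0"
    by (simp add: \<Phi>_def)
  finally have "(\<integral>\<omega>. \<Phi> (hist n \<omega>) \<partial>M) \<le> 0" .
  moreover have "(\<integral>\<omega>. (b - a) * real (upcrossings Y a b (hist n \<omega>)) - a \<partial>M) \<le> (\<integral>\<omega>. \<Phi> (hist n \<omega>) \<partial>M)"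
  proof (rule integral_mono)
    show "(b - a) * real (upcrossings Y a b (hist n \<omega>)) - a \<le> \<Phi> (hist n \<omega>)" for \<omega>
      using nonneg[of "hist n \<omega>"] ab by (auto simp: \<Phi>_def)
  qed (rule integrable_hist)+
  moreover have "(\<integral>\<omega>. (b - a) * real (upcrossings Y a b (hist n \<omega>)) - a \<partial>M)
      = (b - a) * (\<integral>\<omega>. real (upcrossings Y a b (hist n \<omega>)) \<partial>M) - a"
    using integrable_hist[of "\<lambda>l. real (upcrossings Y a b l)"] by (simp add: prob_space)
  ultimately show ?thesis
    using ab by (simp add: field_simps)
qed

lemma AE_bounded_upcrossings:
  fixes Y :: "'e list \<Rightarrow> real"
  assumes nonneg: "\<And>l. Y l \<ge> 0" and super: "\<And>l. (\<Sum>e\<in>UNIV. q e * Y (e # l)) \<le> Y l"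
    and ab: "0 < a" "a < b"
  shows "AE \<omega> in M. \<exists>K. \<forall>n. upcrossings Y a b (hist n \<omega>) \<le> K"
proof -
  define u where "u n \<omega> = ennreal (real (upcrossings Y a b (hist n \<omega>)))" for n \<omega>
  have "incseq u"
    unfolding u_def by (rule incseq_SucI) (auto intro!: le_funI ennreal_leI)
  moreover have [measurable]: "u n \<in> borel_measurable M" for n
    unfolding u_def by (rule borel_measurable_hist)
  ultimately have "(\<integral>\<^sup>+\<omega>. (SUP n. u n \<omega>) \<partial>M) = (SUP n. \<integral>\<^sup>+\<omega>. u n \<omega> \<partial>M)"
    by (intro nn_integral_monotone_convergence_SUP) auto
  also have "\<dots> \<le> ennreal (a / (b - a))"
  proof (rule SUP_least)
    fix n
    have "(\<integral>\<^sup>+\<omega>. u n \<omega> \<partial>M) = ennreal (\<integral>\<omega>. real (upcrossings Y a b (hist n \<omega>)) \<partial>M)"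
      unfolding u_def by (intro nn_integral_eq_integral integrable_hist) auto
    then show "(\<integral>\<^sup>+\<omega>. u n \<omega> \<partial>M) \<le> ennreal (a / (b - a))"
      using expected_upcrossings_le[OF assms] by (simp add: ennreal_leI)
  qed
  finally have "(\<integral>\<^sup>+\<omega>. (SUP n. u n \<omega>) \<partial>M) \<noteq> \<infinity>"
    by (auto simp: top_unique)
  then have "AE \<omega> in M. (SUP n. u n \<omega>) \<noteq> \<infinity>"
    by (intro nn_integral_PInf_AE) auto
  then show ?thesis
  proof eventually_elim
    case (elim \<omega>)
    then obtain c where c: "(SUP n. u n \<omega>) = ennreal c" "c \<ge> 0"
      by (cases "SUP n. u n \<omega>") auto
    have "real (upcrossings Y a b (hist n \<omega>)) \<le> c" for n
    proof -
      have "u n \<omega> \<le> ennreal c"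
        unfolding c(1)[symmetric] by (rule SUP_upper) simp
      then show ?thesis
        using c(2) by (simp add: u_def)
    qed
    then show ?case
      by (intro exI[of _ "nat \<lfloor>c\<rfloor>"]) (simp add: le_nat_floor)
  qed
qed

text \<open>After the last completed round, a value below \<open>a\<close> opens a position or finds
  one open. It is never closed again, and this forbids later values above \<open>b\<close>.\<close>

lemma no_oscillation_if_bounded_upcrossings:
  assumes K: "\<And>n. upcrossings Y a b (hist n \<omega>) \<le> K"
  shows "\<not> ((\<exists>\<^sub>F n in sequentially. Y (hist n \<omega>) < a) \<and> (\<exists>\<^sub>F n in sequentially. b < Y (hist n \<omega>)))"
proof
  assume osc: "(\<exists>\<^sub>F n in sequentially. Y (hist n \<omega>) < a) \<and> (\<exists>\<^sub>F n in sequentially. b < Y (hist n \<omega>))"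
  define U where "U n = upcrossings Y a b (hist n \<omega>)" for n
  define m where "m = Max (range U)"
  have fin: "finite (range U)"
    by (rule finite_subset[of _ "{..K}"]) (use K in \<open>auto simp: U_def\<close>)
  then have "m \<in> range U"
    unfolding m_def by (rule Max_in) simp
  then obtain N where N: "U N = m"
    by auto
  have le: "U n \<le> m" for n
    unfolding m_def using fin by (intro Max_ge) auto
  have "mono U"
    unfolding U_def by (rule incseq_SucI) simp
  then have const: "U n = m" if "n \<ge> N" for n
    using le[of n] monoD[OF \<open>mono U\<close> that] N by simp
  have stay: "holding Y a b (hist (Suc n) \<omega>)" if "n \<ge> N" "holding Y a b (hist n \<omega>)" for n
    using const[of n] const[of "Suc n"] that by (auto simp: U_def split: if_splits)
  obtain n1 where n1: "n1 > N" "Y (hist n1 \<omega>) < a"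
    using osc unfolding frequently_sequentially by (metis Suc_le_lessD)
  obtain n0 where n0: "n1 = Suc n0" "n0 \<ge> N"
    using n1(1) by (cases n1) auto
  have hold1: "holding Y a b (hist n1 \<omega>)"
    using stay[of n0] n1 n0 by (cases "holding Y a b (hist n0 \<omega>)") auto
  have hold: "holding Y a b (hist n \<omega>)" if "n \<ge> n1" for n
    using that
  proof (induction n rule: dec_induct)
    case (step n)
    then show ?case
      using stay[of n] n1(1) by linarith
  qed (rule hold1)
  \<comment> \<open>Strictly later than \<open>n1\<close>: the bound by \<open>b\<close> applies
    only if the position is held at the preceding time.\<close>
  obtain n2 where n2: "n2 > n1" "b < Y (hist n2 \<omega>)"
    using osc unfolding frequently_sequentially by (metis Suc_le_lessD)
  obtain n3 where n3: "n2 = Suc n3" "n3 \<ge> n1"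
    using n2(1) by (cases n2) auto
  have "Y (hist n2 \<omega>) \<le> b"
    using hold[of n3] hold[of n2] n2 n3 by (auto simp del: hist_Suc simp: hist_Suc[of n3])
  with n2(2) show False
    by simp
qed

text \<open>Doob's convergence theorem. Fatou's lemma excludes divergence to infinity, and the
  upcrossing bound, taken over countably many pairs of rational levels, excludes
  oscillation.\<close>

theorem AE_convergent_supermartingale:
  fixes Y :: "'e list \<Rightarrow> real"
  assumes nonneg: "\<And>l. Y l \<ge> 0" and super: "\<And>l. (\<Sum>e\<in>UNIV. q e * Y (e # l)) \<le> Y l"
  shows "AE \<omega> in M. convergent (\<lambda>n. Y (hist n \<omega>))"
proof -
  have "(\<integral>\<^sup>+\<omega>. liminf (\<lambda>n. ennreal (Y (hist n \<omega>))) \<partial>M) \<le> liminf (\<lambda>n. \<integral>\<^sup>+\<omega>. ennreal (Y (hist n \<omega>)) \<partial>M)"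
    by (rule nn_integral_liminf) (rule borel_measurable_hist)
  also have "\<dots> \<le> liminf (\<lambda>n. ennreal (Y []))"
  proof (rule Liminf_mono, rule always_eventually, rule allI)
    fix n
    have "(\<integral>\<^sup>+\<omega>. ennreal (Y (hist n \<omega>)) \<partial>M) = ennreal (\<integral>\<omega>. Y (hist n \<omega>) \<partial>M)"
      using nonneg by (intro nn_integral_eq_integral integrable_hist) auto
    then show "(\<integral>\<^sup>+\<omega>. ennreal (Y (hist n \<omega>)) \<partial>M) \<le> ennreal (Y [])"
      using integral_supermartingale_le[of Y n, OF super] by (simp add: ennreal_leI)
  qed
  finally have "(\<integral>\<^sup>+\<omega>. liminf (\<lambda>n. ennreal (Y (hist n \<omega>))) \<partial>M) \<noteq> \<infinity>"
    by (auto simp: Liminf_const top_unique)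
  then have "AE \<omega> in M. liminf (\<lambda>n. ennreal (Y (hist n \<omega>))) \<noteq> \<infinity>"
    by (intro nn_integral_PInf_AE borel_measurable_liminf borel_measurable_hist)
  moreover have "AE \<omega> in M. \<forall>a\<in>{a \<in> \<rat>. 0 < a}. \<forall>b\<in>{b \<in> \<rat>. a < b}. \<exists>K. \<forall>n. upcrossings Y a b (hist n \<omega>) \<le> K"
  proof (intro AE_ball_countable[THEN iffD2] ballI)
    show "countable {a \<in> \<rat>. (0::real) < a}" "countable {b \<in> \<rat>. a < b}" for a :: real
      by (rule countable_subset[OF _ countable_rat], auto)+
  qed (use AE_bounded_upcrossings[OF assms] in auto)
  ultimately show ?thesis
  proof eventually_elim
    case (elim \<omega>)
    show ?case
    proof (rule convergent_if_no_oscillation)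
      show "liminf (\<lambda>n. ereal (Y (hist n \<omega>))) < \<infinity>"
      proof (rule ccontr)
        assume "\<not> ?thesis"
        then have *: "liminf (\<lambda>n. ereal (Y (hist n \<omega>))) = \<infinity>"
          by simp
        then have "(\<lambda>n. ereal (Y (hist n \<omega>))) \<longlonglongrightarrow> \<infinity>"
          using Liminf_PInfty by (metis trivial_limit_sequentially)
        then have "(\<lambda>n. e2ennreal (ereal (Y (hist n \<omega>)))) \<longlonglongrightarrow> e2ennreal \<infinity>"
          by (rule tendsto_e2ennrealI)
        then have "(\<lambda>n. ennreal (Y (hist n \<omega>))) \<longlonglongrightarrow> \<infinity>"
          by simp
        then have "liminf (\<lambda>n. ennreal (Y (hist n \<omega>))) = \<infinity>"
          by (intro lim_imp_Liminf) auto
        with elim(1) show False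
          by simp
      qed
      show "\<not> ((\<exists>\<^sub>F n in sequentially. Y (hist n \<omega>) < a) \<and> (\<exists>\<^sub>F n in sequentially. b < Y (hist n \<omega>)))"
        if "a \<in> \<rat>" "b \<in> \<rat>" "0 < a" "a < b" for a b
      proof -
        have "\<exists>K. \<forall>n. upcrossings Y a b (hist n \<omega>) \<le> K"
          using elim(2)[THEN bspec, of a, THEN bspec, of b] that by simp
        then show ?thesis
          using no_oscillation_if_bounded_upcrossings[of Y a b \<omega>] by auto
      qed
    qed (rule nonneg)
  qed
qed

end

section \<open>One step of the block proximal gradient method\<close>

lemma subspace_direct_sum: "(\<And>i. subspace (V i)) \<Longrightarrow> subspace (direct_sum V)"
  by (auto simp: subspace_def direct_sum_def)

lemma closed_direct_sum:
  assumes "\<And>i. closed (V i)"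
  shows "closed (direct_sum V)"
proof -
  have "direct_sum V = (\<Inter>i. (\<lambda>x. x $ i) -` V i)"
    by (auto simp: direct_sum_def)
  then show ?thesis
    by (simp only:) (intro closed_INT ballI closed_vimage_vec_nth assms)
qed

text \<open>The law of the mask enters through its weights \<open>q\<close>, and the smoothness
  hypothesis is a finite sum; all one-step estimates are thus free of measure theory.\<close>

locale block_prox_gradient =
  fixes V :: "'m::finite \<Rightarrow> 'a::{real_inner, complete_space, second_countable_topology} set"
    and f :: "'a ^ 'm \<Rightarrow> real" and h :: "'m \<Rightarrow> 'a \<Rightarrow> ereal"
    and q :: "('m \<Rightarrow> bool) \<Rightarrow> real" and p \<nu> \<gamma> :: "'m \<Rightarrow> real"
  assumes V_subspace: "\<And>i. subspace (V i)"
    and V_closed: "\<And>i. closed (V i)"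
    and f_convex: "convex_on (direct_sum V) f"
    and f_diff: "\<And>y. y \<in> direct_sum V \<Longrightarrow> f differentiable (at y within direct_sum V)"
    and h_proper: "\<And>i. proper_on (V i) (h i)"
    and h_convex: "\<And>i. ereal_convex_on (V i) (h i)"
    and h_lsc: "\<And>i. lsc_on (V i) (h i)"
    and q_nonneg: "\<And>e. q e \<ge> 0" and sum_q: "(\<Sum>e\<in>UNIV. q e) = 1"
    and p_eq: "\<And>i. p i = (\<Sum>e\<in>UNIV. q e * of_bool (e i))"
    and p_pos: "\<And>i. p i > 0"
    and \<gamma>_pos: "\<And>i. \<gamma> i > 0" and \<gamma>_less: "\<And>i. \<gamma> i * \<nu> i < 2"
    and smooth: "\<And>y v. y \<in> direct_sum V \<Longrightarrow> v \<in> direct_sum V \<Longrightarrow>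
      (\<Sum>e\<in>UNIV. q e * f (y + e \<odot> v)) \<le> f y + (\<Sum>i\<in>UNIV. p i * (gradient_on (direct_sum V) f y $ i \<bullet> v $ i))
        + 1 / 2 * (\<Sum>i\<in>UNIV. p i * \<nu> i * (norm (v $ i))\<^sup>2)"
begin

abbreviation H :: "('a ^ 'm) set" where
  "H \<equiv> direct_sum V"

abbreviation G :: "'a ^ 'm \<Rightarrow> 'a ^ 'm" where
  "G \<equiv> gradient_on H f"

text \<open>\<open>real_of_ereal\<close> sends infinite values to 0, so \<open>hr\<close>, and with
  it \<open>Fr\<close>, has its meaning only where \<open>h\<close> is finite.\<close>

definition hr :: "'m \<Rightarrow> 'a \<Rightarrow> real" where
  "hr i z = real_of_ereal (h i z)"

definition Fdom :: "('a ^ 'm) set" where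
  "Fdom = {x \<in> H. \<forall>i. h i (x $ i) < \<infinity>}"

definition Fr :: "'a ^ 'm \<Rightarrow> real" where
  "Fr x = f x + (\<Sum>i\<in>UNIV. hr i (x $ i))"

definition T :: "'a ^ 'm \<Rightarrow> 'm \<Rightarrow> 'a" where
  "T x i = prox_on (V i) (\<lambda>z. ereal (\<gamma> i) * h i z) (x $ i - \<gamma> i *\<^sub>R (G x $ i))"

definition step :: "'a ^ 'm \<Rightarrow> ('m \<Rightarrow> bool) \<Rightarrow> 'a ^ 'm" where
  "step x e = x + e \<odot> (\<chi> i. T x i - x $ i)"

definition W :: "'a ^ 'm \<Rightarrow> 'a ^ 'm" where
  "W x = (\<chi> i. (1 / (\<gamma> i * p i)) *\<^sub>R (x $ i))"

definition N :: "'a ^ 'm \<Rightarrow> real" where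
  "N x = (\<Sum>i\<in>UNIV. 1 / (\<gamma> i * p i) * (norm (x $ i))\<^sup>2)"

definition \<delta> :: real where
  "\<delta> = Max (range (\<lambda>i. \<gamma> i * \<nu> i))"

definition p_min :: real where
  "p_min = Min (range p)"

definition c :: real where
  "c = max 1 (1 / (2 - \<delta>)) / p_min"

lemma H_subspace: "subspace H" and H_closed: "closed H"
  by (rule subspace_direct_sum[OF V_subspace], rule closed_direct_sum[OF V_closed])

lemma HD: "x \<in> H \<Longrightarrow> x $ i \<in> V i"
  by (simp add: direct_sum_def)

lemma h_real: "z \<in> V i \<Longrightarrow> h i z < \<infinity> \<Longrightarrow> h i z = ereal (hr i z)"
  using h_proper[of i] by (cases "h i z") (auto simp: hr_def proper_on_def)

lemma FdomD: "x \<in> Fdom \<Longrightarrow> x \<in> H" "x \<in> Fdom \<Longrightarrow> h i (x $ i) = ereal (hr i (x $ i))"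
  by (simp_all add: Fdom_def HD h_real)

lemma F_real: "x \<in> Fdom \<Longrightarrow> ereal (f x) + separable_sum h x = ereal (Fr x)"
  by (simp add: separable_sum_def FdomD Fr_def)

lemma F_finite_iff: "x \<in> H \<Longrightarrow> separable_sum h x < \<infinity> \<longleftrightarrow> x \<in> Fdom"
  by (simp add: separable_sum_def Fdom_def sum_Pinfty)

lemma T:
  assumes x: "x \<in> H"
  shows T_in: "T x i \<in> V i" and h_T: "h i (T x i) = ereal (hr i (T x i))"
    and T_variational: "z \<in> V i \<Longrightarrow> h i z < \<infinity> \<Longrightarrow>
      hr i (T x i) \<le> hr i z + (x $ i - T x i) \<bullet> (T x i - z) / \<gamma> i + G x $ i \<bullet> (z - T x i)"
proof -
  obtain a where a: "T x i \<in> V i" "ereal (\<gamma> i) * h i (T x i) = ereal a"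
    "\<And>z b. z \<in> V i \<Longrightarrow> ereal (\<gamma> i) * h i z = ereal b \<Longrightarrow>
      (x $ i - \<gamma> i *\<^sub>R (G x $ i) - T x i) \<bullet> (z - T x i) \<le> b - a"
    using prox_on_characterization[OF V_closed proper_on_scale[OF h_proper \<gamma>_pos[of i]]
        ereal_convex_on_scale[OF h_proper h_convex \<gamma>_pos[of i]] lsc_on_scale[OF h_lsc \<gamma>_pos[of i]],
        where x = "x $ i - \<gamma> i *\<^sub>R (G x $ i)"]
    unfolding T_def by blast
  show "T x i \<in> V i"
    by (rule a)
  have "h i (T x i) < \<infinity>"
    using a(2) \<gamma>_pos[of i] by (cases "h i (T x i)") auto
  then show hT: "h i (T x i) = ereal (hr i (T x i))"
    by (intro h_real a)
  then have a_eq: "a = \<gamma> i * hr i (T x i)"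
    using a(2) by simp
  show "hr i (T x i) \<le> hr i z + (x $ i - T x i) \<bullet> (T x i - z) / \<gamma> i + G x $ i \<bullet> (z - T x i)"
    if z: "z \<in> V i" "h i z < \<infinity>"
  proof -
    have "(x $ i - \<gamma> i *\<^sub>R (G x $ i) - T x i) \<bullet> (z - T x i) \<le> \<gamma> i * hr i z - \<gamma> i * hr i (T x i)"
      using a(3)[OF z(1), of "\<gamma> i * hr i z"] h_real[OF z] a_eq by simp
    moreover have "(x $ i - \<gamma> i *\<^sub>R (G x $ i) - T x i) \<bullet> (z - T x i)
        = - ((x $ i - T x i) \<bullet> (T x i - z)) - \<gamma> i * (G x $ i \<bullet> (z - T x i))"
      by (simp add: inner_diff_left inner_diff_right algebra_simps)
    ultimately have "\<gamma> i * hr i (T x i)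
        \<le> \<gamma> i * (hr i z + (x $ i - T x i) \<bullet> (T x i - z) / \<gamma> i + G x $ i \<bullet> (z - T x i))"
      using \<gamma>_pos[of i] by (simp add: distrib_left)
    then show ?thesis
      using \<gamma>_pos[of i] by simp
  qed
qed

section \<open>Masked steps and expectations of separable sums\<close>

lemma step_nth: "step x e $ i = (if e i then T x i else x $ i)"
  by (simp add: step_def mask_def)

lemma T_diff_in_H: "x \<in> H \<Longrightarrow> (\<chi> i. T x i - x $ i) \<in> H"
  by (simp add: direct_sum_def subspace_diff[OF V_subspace] T_in)

lemma step_in_Fdom:
  assumes "x \<in> Fdom"
  shows "step x e \<in> Fdom"
proof -
  have x: "x \<in> H"
    using assms by (rule FdomD)
  have "h i (T x i) < \<infinity>" for i
    using h_T[OF x] by simp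
  then show ?thesis
    using assms T_in[OF x] HD[OF x] by (auto simp: Fdom_def direct_sum_def step_nth)
qed

text \<open>Each summand depends on a single coordinate of the mask, so only the marginals
  \<open>p i\<close> enter, whatever the joint law.\<close>

lemma sum_q_separable:
  "(\<Sum>e\<in>UNIV. q e * (\<Sum>i\<in>UNIV. if e i then a i else b i)) = (\<Sum>i\<in>UNIV. b i + p i * (a i - b i))"
proof -
  have "(\<Sum>e\<in>UNIV. q e * (\<Sum>i\<in>UNIV. if e i then a i else b i))
      = (\<Sum>e\<in>UNIV. \<Sum>i\<in>UNIV. q e * b i + q e * of_bool (e i) * (a i - b i))"
    unfolding sum_distrib_left by (intro sum.cong) (auto simp: algebra_simps)
  also have "\<dots> = (\<Sum>i\<in>UNIV. \<Sum>e\<in>UNIV. q e * b i + q e * of_bool (e i) * (a i - b i))"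
    by (rule sum.swap)
  also have "\<dots> = (\<Sum>i\<in>UNIV. b i + p i * (a i - b i))"
    by (intro sum.cong) (auto simp: sum.distrib sum_distrib_right[symmetric] sum_q p_eq)
  finally show ?thesis .
qed

text \<open>\<open>A x i\<close> is the decrease of \<open>h i\<close> plus the linearization of
  \<open>f\<close> when block \<open>i\<close> moves from \<open>x $ i\<close> to
  \<open>T x i\<close>; \<open>B x i\<close> is the squared length of that move, scaled by the step
  size.\<close>

definition A :: "'a ^ 'm \<Rightarrow> 'm \<Rightarrow> real" where
  "A x i = hr i (x $ i) - hr i (T x i) - G x $ i \<bullet> (T x i - x $ i)"

definition B :: "'a ^ 'm \<Rightarrow> 'm \<Rightarrow> real" where
  "B x i = (norm (T x i - x $ i))\<^sup>2 / \<gamma> i"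

lemma B_nonneg: "B x i \<ge> 0"
  using \<gamma>_pos[of i] by (simp add: B_def)

text \<open>The prox inequality tested at the current point. With
  \<open>\<gamma> i * \<nu> i < 2\<close> it makes
  \<open>A x i - \<gamma> i * \<nu> i * B x i / 2\<close> nonnegative, so the expected objective
  does not increase.\<close>

lemma B_le_A:
  assumes x: "x \<in> Fdom"
  shows "B x i \<le> A x i"
proof -
  have "hr i (T x i) \<le> hr i (x $ i) + (x $ i - T x i) \<bullet> (T x i - x $ i) / \<gamma> i + G x $ i \<bullet> (x $ i - T x i)"
    using x by (intro T_variational) (auto simp: FdomD HD)
  moreover have "(x $ i - T x i) \<bullet> (T x i - x $ i) = - (norm (T x i - x $ i))\<^sup>2"
    by (simp add: power2_norm_eq_inner inner_diff_left inner_diff_right)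
  moreover have "G x $ i \<bullet> (x $ i - T x i) = - (G x $ i \<bullet> (T x i - x $ i))"
    by (simp add: inner_diff_right)
  ultimately show ?thesis
    by (simp add: A_def B_def)
qed

text \<open>Smoothness is applied with the full unmasked step as \<open>v\<close>, and the masked
  penalties average through the marginals. The factor \<open>\<gamma> i\<close> in the quadratic
  term compensates the division by \<open>\<gamma> i\<close> in \<open>B\<close>.\<close>

lemma descent:
  assumes x: "x \<in> Fdom"
  shows "(\<Sum>e\<in>UNIV. q e * Fr (step x e)) \<le> Fr x - (\<Sum>i\<in>UNIV. p i * (A x i - \<gamma> i * \<nu> i * B x i / 2))"
proof -
  define d where "d = (\<chi> i. T x i - x $ i)"
  have xH: "x \<in> H"
    using x by (rule FdomD)
  have dH: "d \<in> H"
    unfolding d_def by (rule T_diff_in_H[OF xH])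
  have "(\<Sum>e\<in>UNIV. q e * Fr (step x e)) = (\<Sum>e\<in>UNIV. q e * f (x + e \<odot> d))
      + (\<Sum>e\<in>UNIV. q e * (\<Sum>i\<in>UNIV. if e i then hr i (T x i) else hr i (x $ i)))"
    unfolding sum.distrib[symmetric] distrib_left[symmetric]
    by (intro sum.cong arg_cong2[where f = "(*)"] refl)
      (auto simp: Fr_def step_nth step_def[symmetric] d_def intro!: sum.cong)
  also have "\<dots> = (\<Sum>e\<in>UNIV. q e * f (x + e \<odot> d))
      + (\<Sum>i\<in>UNIV. hr i (x $ i) + p i * (hr i (T x i) - hr i (x $ i)))"
    by (simp only: sum_q_separable)
  also have "\<dots> \<le> f x + (\<Sum>i\<in>UNIV. p i * (G x $ i \<bullet> d $ i)) + 1 / 2 * (\<Sum>i\<in>UNIV. p i * \<nu> i * (norm (d $ i))\<^sup>2)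
      + (\<Sum>i\<in>UNIV. hr i (x $ i) + p i * (hr i (T x i) - hr i (x $ i)))"
    using smooth[OF xH dH] by simp
  also have "\<dots> = f x + (\<Sum>i\<in>UNIV. p i * (G x $ i \<bullet> d $ i) + 1 / 2 * (p i * \<nu> i * (norm (d $ i))\<^sup>2)
      + (hr i (x $ i) + p i * (hr i (T x i) - hr i (x $ i))))"
    by (simp add: sum.distrib sum_distrib_left)
  also have "\<dots> = f x + (\<Sum>i\<in>UNIV. hr i (x $ i) - p i * (A x i - \<gamma> i * \<nu> i * B x i / 2))"
    using \<gamma>_pos by (intro arg_cong2[where f = "(+)"] sum.cong refl)
      (auto simp: A_def B_def d_def algebra_simps less_imp_neq[symmetric])
  also have "\<dots> = Fr x - (\<Sum>i\<in>UNIV. p i * (A x i - \<gamma> i * \<nu> i * B x i / 2))"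
    by (simp add: Fr_def sum_subtractf)
  finally show ?thesis .
qed

text \<open>In block \<open>i\<close> the probability \<open>p i\<close> of an update cancels
  against the weight \<open>1 / (\<gamma> i * p i)\<close>, leaving the factor
  \<open>1 / \<gamma> i\<close> of the prox inequality. The cosine rule turns its inner product into
  distances, and the gradient inequality compares \<open>f x\<close> with
  \<open>f z\<close>.\<close>

lemma distance_estimate:
  assumes x: "x \<in> Fdom" and z: "z \<in> Fdom"
  shows "(\<Sum>e\<in>UNIV. q e * (N (step x e - z) / 2))
    \<le> N (x - z) / 2 - (Fr x - Fr z) + (\<Sum>i\<in>UNIV. A x i - B x i / 2)"
proof -
  have xH: "x \<in> H" and zH: "z \<in> H"
    using x z by (auto simp: FdomD)
  define w where "w i = 1 / (\<gamma> i * p i)" for i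
  have "(\<Sum>e\<in>UNIV. q e * (N (step x e - z) / 2)) = (\<Sum>e\<in>UNIV. q e *
      (\<Sum>i\<in>UNIV. if e i then w i * (norm (T x i - z $ i))\<^sup>2 / 2 else w i * (norm (x $ i - z $ i))\<^sup>2 / 2))"
    unfolding N_def sum_divide_distrib
    by (intro sum.cong arg_cong2[where f = "(*)"] refl) (auto simp: step_nth w_def)
  also have "\<dots> = (\<Sum>i\<in>UNIV. w i * (norm (x $ i - z $ i))\<^sup>2 / 2
      + p i * (w i * (norm (T x i - z $ i))\<^sup>2 / 2 - w i * (norm (x $ i - z $ i))\<^sup>2 / 2))"
    by (rule sum_q_separable)
  also have "\<dots> \<le> (\<Sum>i\<in>UNIV. w i * (norm (x $ i - z $ i))\<^sup>2 / 2
      + (hr i (z $ i) - hr i (x $ i) + G x $ i \<bullet> (z $ i - x $ i) + A x i - B x i / 2))"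
  proof (intro sum_mono add_left_mono)
    fix i
    have sq: "(norm (x $ i - z $ i))\<^sup>2
        = (norm (T x i - x $ i))\<^sup>2 + 2 * ((x $ i - T x i) \<bullet> (T x i - z $ i)) + (norm (T x i - z $ i))\<^sup>2"
      by (simp add: power2_norm_eq_inner inner_diff_left inner_diff_right inner_commute)
    have "p i * (w i * (norm (T x i - z $ i))\<^sup>2 / 2 - w i * (norm (x $ i - z $ i))\<^sup>2 / 2)
        = - ((x $ i - T x i) \<bullet> (T x i - z $ i) / \<gamma> i) - B x i / 2"
      unfolding sq using p_pos[of i] \<gamma>_pos[of i] by (simp add: w_def B_def field_simps)
    also have "\<dots> \<le> hr i (z $ i) - hr i (T x i) + G x $ i \<bullet> (z $ i - T x i) - B x i / 2"
      using T_variational[OF xH, of "z $ i" i] z by (auto simp: FdomD HD)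
    also have "\<dots> = hr i (z $ i) - hr i (x $ i) + G x $ i \<bullet> (z $ i - x $ i) + A x i - B x i / 2"
      by (simp add: A_def inner_diff_right)
    finally show "p i * (w i * (norm (T x i - z $ i))\<^sup>2 / 2 - w i * (norm (x $ i - z $ i))\<^sup>2 / 2)
        \<le> hr i (z $ i) - hr i (x $ i) + G x $ i \<bullet> (z $ i - x $ i) + A x i - B x i / 2" .
  qed
  also have "\<dots> = N (x - z) / 2 + ((\<Sum>i\<in>UNIV. hr i (z $ i)) - (\<Sum>i\<in>UNIV. hr i (x $ i)))
      + G x \<bullet> (z - x) + (\<Sum>i\<in>UNIV. A x i - B x i / 2)"
    by (simp add: N_def w_def inner_vec_def sum.distrib sum_subtractf sum_divide_distrib)
  also have "\<dots> \<le> N (x - z) / 2 - (Fr x - Fr z) + (\<Sum>i\<in>UNIV. A x i - B x i / 2)"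
    using convex_on_gradient_inequality[OF H_subspace H_closed f_convex f_diff[OF xH] xH zH]
    by (simp add: Fr_def)
  finally show ?thesis .
qed

lemma p_min: "0 < p_min" "p_min \<le> p i"
  unfolding p_min_def using p_pos by (auto simp: Min_gr_iff)

lemma p_le_1: "p i \<le> 1"
proof -
  have "p i \<le> (\<Sum>e\<in>UNIV. q e)"
    unfolding p_eq by (intro sum_mono) (simp add: q_nonneg)
  then show ?thesis
    by (simp add: sum_q)
qed

lemma \<delta>: "\<delta> < 2" "\<gamma> i * \<nu> i \<le> \<delta>"
  unfolding \<delta>_def using \<gamma>_less by (auto simp: Max_less_iff)

lemma c_ge_1: "c \<ge> 1"
proof -
  have "p_min \<le> 1"
    using p_min(2) p_le_1 order_trans by blast
  then show ?thesis
    unfolding c_def using p_min(1) by (simp add: field_simps max.coboundedI1)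
qed

lemma A_B_estimate:
  assumes x: "x \<in> Fdom"
  shows "A x i - B x i / 2 \<le> c * (p i * (A x i - \<gamma> i * \<nu> i * B x i / 2))"
    and "A x i - \<gamma> i * \<nu> i * B x i / 2 \<ge> 0"
proof -
  define m where "m = max 1 (1 / (2 - \<delta>))"
  define a b where "a = A x i" and "b = B x i"
  have ab: "0 \<le> b" "b \<le> a"
    using B_nonneg B_le_A[OF x] by (auto simp: a_def b_def)
  have \<delta>b: "\<gamma> i * \<nu> i * b \<le> \<delta> * b"
    using ab \<delta>(2) by (intro mult_right_mono)
  have "\<delta> * b \<le> 2 * b"
    using ab \<delta>(1) by (intro mult_right_mono) auto
  with \<delta>b ab show nonneg: "A x i - \<gamma> i * \<nu> i * B x i / 2 \<ge> 0"
    unfolding a_def[symmetric] b_def[symmetric] by linarith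
  \<comment> \<open>The quotient of \<open>a - b / 2\<close> and \<open>a - \<delta> * b / 2\<close>
    is monotone in \<open>b / a\<close>: its maximum is 1, at \<open>b = 0\<close>, if
    \<open>\<delta> \<le> 1\<close>, and \<open>1 / (2 - \<delta>)\<close>, at \<open>b = a\<close>,
    otherwise.\<close>
  have "a - b / 2 \<le> m * (a - \<delta> * b / 2)"
  proof (cases "\<delta> \<le> 1")
    case True
    then have "\<delta> * b \<le> b"
      using ab mult_right_mono[of \<delta> 1 b] by simp
    then have "a - b / 2 \<le> 1 * (a - \<delta> * b / 2)"
      by simp
    also have "\<dots> \<le> m * (a - \<delta> * b / 2)"
      using \<open>\<delta> * b \<le> 2 * b\<close> ab by (intro mult_right_mono) (auto simp: m_def)
    finally show ?thesis .
  next
    case False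
    have "0 \<le> (\<delta> - 1) * (a - b)"
      using False ab by simp
    then have "(2 - \<delta>) * (a - b / 2) \<le> a - \<delta> * b / 2"
      by (simp add: algebra_simps)
    then have "a - b / 2 \<le> 1 / (2 - \<delta>) * (a - \<delta> * b / 2)"
      using \<delta>(1) by (simp add: field_simps)
    also have "\<dots> \<le> m * (a - \<delta> * b / 2)"
      using \<open>\<delta> * b \<le> 2 * b\<close> ab by (intro mult_right_mono) (auto simp: m_def)
    finally show ?thesis .
  qed
  also have "\<dots> \<le> m * (a - \<gamma> i * \<nu> i * b / 2)"
    using \<delta>b by (intro mult_left_mono) (auto simp: m_def)
  \<comment> \<open>The factor \<open>p i / p_min\<close> is at least 1 and introduces the
    probability that the expected decrease carries.\<close>
  also have "\<dots> \<le> m * (a - \<gamma> i * \<nu> i * b / 2) * (p i / p_min)"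
    using nonneg p_min(1) p_min(2)[of i] unfolding a_def[symmetric] b_def[symmetric]
    by (intro mult_le_cancel_left1[THEN iffD2]) (auto simp: m_def mult_less_0_iff)
  finally show "A x i - B x i / 2 \<le> c * (p i * (A x i - \<gamma> i * \<nu> i * B x i / 2))"
    unfolding a_def b_def m_def c_def by (simp add: field_simps)
qed

lemma expected_Fr_le:
  assumes "x \<in> Fdom"
  shows "(\<Sum>e\<in>UNIV. q e * Fr (step x e)) \<le> Fr x"
proof -
  have "(\<Sum>i\<in>UNIV. p i * (A x i - \<gamma> i * \<nu> i * B x i / 2)) \<ge> 0"
    using A_B_estimate(2)[OF assms] p_pos by (intro sum_nonneg mult_nonneg_nonneg) (auto intro: less_imp_le)
  with descent[OF assms] show ?thesis
    by linarith
qed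

text \<open>\<open>c\<close> times the expected decrease of \<open>Fr\<close> pays for the error of
  \<open>distance_estimate\<close>; what is left is the gap \<open>Fr x - Fr z\<close>.\<close>

lemma expected_lyapunov_le:
  assumes x: "x \<in> Fdom" and z: "z \<in> Fdom"
  shows "(\<Sum>e\<in>UNIV. q e * (N (step x e - z) / 2 + c * Fr (step x e)))
    \<le> N (x - z) / 2 + c * Fr x - (Fr x - Fr z)"
proof -
  have "(\<Sum>i\<in>UNIV. A x i - B x i / 2) \<le> c * (\<Sum>i\<in>UNIV. p i * (A x i - \<gamma> i * \<nu> i * B x i / 2))"
    unfolding sum_distrib_left by (intro sum_mono A_B_estimate x)
  also have "\<dots> \<le> c * (Fr x - (\<Sum>e\<in>UNIV. q e * Fr (step x e)))"
    using descent[OF x] c_ge_1 by (intro mult_left_mono) auto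
  finally have "(\<Sum>i\<in>UNIV. A x i - B x i / 2) \<le> c * Fr x - c * (\<Sum>e\<in>UNIV. q e * Fr (step x e))"
    by (simp add: algebra_simps)
  moreover have "(\<Sum>e\<in>UNIV. q e * (N (step x e - z) / 2 + c * Fr (step x e)))
      = (\<Sum>e\<in>UNIV. q e * (N (step x e - z) / 2)) + c * (\<Sum>e\<in>UNIV. q e * Fr (step x e))"
    by (simp add: distrib_left sum.distrib sum_distrib_left mult.left_commute)
  ultimately show ?thesis
    using distance_estimate[OF x z] by linarith
qed

section \<open>Sublevel sets of the objective\<close>

lemma continuous_on_f: "continuous_on H f"
  using f_diff differentiable_imp_continuous_within by (auto simp: continuous_on_eq_continuous_within)

text \<open>Lower semicontinuity of a sum whose terms may be infinite at the limit: real numbers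
  \<open>b i\<close> strictly below \<open>h i (u $ i)\<close> are eventually below
  \<open>h i\<close> along the sequence, so \<open>key\<close> bounds their sum. Letting one
  \<open>b j\<close> grow shows that no term is infinite; letting all approach the values at
  \<open>u\<close> gives the claim.\<close>

lemma closed_sublevel: "closed {x \<in> Fdom. Fr x \<le> \<alpha>}"
  unfolding closed_sequential_limits
proof (intro allI impI)
  fix z u assume "(\<forall>n. z n \<in> {x \<in> Fdom. Fr x \<le> \<alpha>}) \<and> z \<longlonglongrightarrow> u"
  then have z: "\<And>n. z n \<in> Fdom" "\<And>n. Fr (z n) \<le> \<alpha>" and zu: "z \<longlonglongrightarrow> u"
    by auto
  have zH: "z n \<in> H" for n
    using z(1) by (rule FdomD)
  have u: "u \<in> H"
    using H_closed zH zu closed_sequentially by metis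
  have f: "(\<lambda>n. f (z n)) \<longlonglongrightarrow> f u"
    using continuous_on_tendsto_compose[OF continuous_on_f zu u] zH by simp
  have key: "(\<Sum>i\<in>UNIV. b i) \<le> \<alpha> - f u" if b: "\<And>i. ereal (b i) < h i (u $ i)" for b
  proof -
    have "eventually (\<lambda>n. ereal (b i) < h i (z n $ i)) sequentially" for i
    proof (rule ccontr)
      assume "\<not> ?thesis"
      then have "infinite {n. h i (z n $ i) \<le> ereal (b i)}"
        by (auto simp: not_eventually not_less frequently_sequentially infinite_nat_iff_unbounded_le)
      then obtain r where r: "strict_mono (r :: nat \<Rightarrow> nat)" "\<And>n. h i (z (r n) $ i) \<le> ereal (b i)"
        using infinite_enumerate by blast
      have "(\<lambda>n. z (r n) $ i) \<longlonglongrightarrow> u $ i"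
        using LIMSEQ_subseq_LIMSEQ[OF zu r(1)] by (auto simp: o_def intro: tendsto_vec_nth)
      then have "h i (u $ i) \<le> ereal (b i)"
        using r(2) HD[OF zH] HD[OF u]
        by (intro lsc_on_lim_le[OF h_lsc, of "u $ i" i "\<lambda>n. z (r n) $ i" "\<lambda>_. ereal (b i)"]) auto
      with b[of i] show False
        by simp
    qed
    then have "eventually (\<lambda>n. \<forall>i. ereal (b i) < h i (z n $ i)) sequentially"
      by (simp add: eventually_all_finite)
    then have "eventually (\<lambda>n. (\<Sum>i\<in>UNIV. b i) \<le> \<alpha> - f (z n)) sequentially"
    proof eventually_elim
      case (elim n)
      then have "(\<Sum>i\<in>UNIV. b i) \<le> (\<Sum>i\<in>UNIV. hr i (z n $ i))"
        by (intro sum_mono) (auto simp: FdomD[OF z(1)] intro: less_imp_le)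
      with z(2)[of n] show ?case
        by (simp add: Fr_def)
    qed
    moreover have "(\<lambda>n. \<alpha> - f (z n)) \<longlonglongrightarrow> \<alpha> - f u"
      by (intro tendsto_intros f)
    ultimately show ?thesis
      by (intro tendsto_lowerbound) auto
  qed
  have ex: "\<exists>b. ereal b < h i (u $ i)" for i
    using h_proper[of i] HD[OF u] by (metis ereal_dense2 proper_on_def ereal_infty_less(2))
  then obtain b where b: "\<And>i. ereal (b i) < h i (u $ i)"
    by metis
  have fin: "h j (u $ j) < \<infinity>" for j
  proof (rule ccontr)
    assume "\<not> ?thesis"
    then have "ereal K < h j (u $ j)" for K
      by simp
    then have "(\<Sum>i\<in>UNIV. (b(j := K)) i) \<le> \<alpha> - f u" for K
      using b by (intro key) auto
    moreover have "(\<Sum>i\<in>UNIV. (b(j := K)) i) = K + (\<Sum>i\<in>UNIV - {j}. b i)" for K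
      by (subst sum.remove[of _ j]) auto
    ultimately have "K + (\<Sum>i\<in>UNIV - {j}. b i) \<le> \<alpha> - f u" for K
      by simp
    from this[of "\<alpha> - f u - (\<Sum>i\<in>UNIV - {j}. b i) + 1"] show False
      by simp
  qed
  then have uF: "u \<in> Fdom"
    using u by (simp add: Fdom_def)
  have "(\<Sum>i\<in>UNIV. hr i (u $ i)) \<le> \<alpha> - f u"
  proof (rule field_le_epsilon)
    fix e :: real assume e: "e > 0"
    have "(\<Sum>i\<in>UNIV. hr i (u $ i) - e / CARD('m)) \<le> \<alpha> - f u"
      using e by (intro key) (auto simp: FdomD[OF uF])
    then show "(\<Sum>i\<in>UNIV. hr i (u $ i)) \<le> \<alpha> - f u + e"
      by (simp add: sum_subtractf)
  qed
  with uF show "u \<in> {x \<in> Fdom. Fr x \<le> \<alpha>}"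
    by (simp add: Fr_def)
qed

lemma convex_sublevel: "convex {x \<in> Fdom. Fr x \<le> \<alpha>}"
proof (rule convexI)
  fix x y and u v :: real
  assume x: "x \<in> {x \<in> Fdom. Fr x \<le> \<alpha>}" and y: "y \<in> {x \<in> Fdom. Fr x \<le> \<alpha>}" and uv: "0 \<le> u" "0 \<le> v" "u + v = 1"
  define w where "w = u *\<^sub>R x + v *\<^sub>R y"
  have xH: "x \<in> H" and yH: "y \<in> H"
    using x y by (auto simp: FdomD)
  have wH: "w \<in> H"
    unfolding w_def using H_subspace xH yH by (intro subspace_add subspace_scale)
  have h: "h i (w $ i) \<le> ereal (u * hr i (x $ i) + v * hr i (y $ i))" for i
    unfolding w_def vector_add_component vector_scaleR_component
    using uv xH yH x y by (intro ereal_convex_onD[OF h_convex]) (auto simp: HD FdomD)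
  then have wF: "w \<in> Fdom"
    using wH le_less_trans unfolding Fdom_def by fastforce
  have "(\<Sum>i\<in>UNIV. hr i (w $ i)) \<le> (\<Sum>i\<in>UNIV. u * hr i (x $ i) + v * hr i (y $ i))"
    using h by (intro sum_mono) (simp add: FdomD[OF wF])
  moreover have "f w \<le> u * f x + v * f y"
    unfolding w_def using f_convex xH yH uv by (auto simp: convex_on_def)
  ultimately have "Fr w \<le> u * Fr x + v * Fr y"
    by (simp add: Fr_def sum.distrib sum_distrib_left distrib_left)
  also have "\<dots> \<le> u * \<alpha> + v * \<alpha>"
    using x y uv by (intro add_mono mult_left_mono) auto
  also have "\<dots> = \<alpha>"
    using uv(3) by (metis distrib_right mult_1)
  finally show "u *\<^sub>R x + v *\<^sub>R y \<in> {x \<in> Fdom. Fr x \<le> \<alpha>}"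
    using wF by (simp add: w_def)
qed

section \<open>The weighted inner product\<close>

lemma W_linear: "bounded_linear W"
proof (rule bounded_linear_intro)
  show "norm (W x) \<le> norm x * (\<Sum>i\<in>UNIV. 1 / (\<gamma> i * p i))" for x
  proof -
    have "norm (W x) \<le> (\<Sum>i\<in>UNIV. norm (W x $ i))"
      unfolding norm_vec_def by (rule L2_set_le_sum) simp
    also have "\<dots> = (\<Sum>i\<in>UNIV. 1 / (\<gamma> i * p i) * norm (x $ i))"
      using \<gamma>_pos p_pos by (intro sum.cong) (auto simp: W_def less_imp_le)
    also have "\<dots> \<le> (\<Sum>i\<in>UNIV. 1 / (\<gamma> i * p i) * norm x)"
      using \<gamma>_pos p_pos by (intro sum_mono mult_left_mono Finite_Cartesian_Product.norm_nth_le)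
        (auto simp: less_imp_le)
    finally show ?thesis
      by (simp add: sum_distrib_left)
  qed
qed (auto simp: W_def vec_eq_iff algebra_simps)

lemma W_selfadjoint: "x \<bullet> W y = W x \<bullet> y"
  by (simp add: inner_vec_def W_def)

lemma N_eq: "N x = x \<bullet> W x"
  by (simp add: N_def inner_vec_def W_def power2_norm_eq_inner)

lemma N_nonneg: "N x \<ge> 0"
  unfolding N_def using p_pos \<gamma>_pos by (intro sum_nonneg) (auto simp: less_imp_le)

text \<open>It turns bounds in the weighted norm into bounds in the norm; the sum of the inverse
  weights serves as a bound for each of them.\<close>

lemma norm_sq_le_N: "(norm x)\<^sup>2 \<le> (\<Sum>i\<in>UNIV. \<gamma> i * p i) * N x"
proof -
  have pos: "\<gamma> i * p i > 0" for i
    using \<gamma>_pos p_pos by simp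
  have "(norm x)\<^sup>2 = (\<Sum>i\<in>UNIV. (\<gamma> i * p i) * (1 / (\<gamma> i * p i) * (norm (x $ i))\<^sup>2))"
  proof -
    have "(\<gamma> i * p i) * (1 / (\<gamma> i * p i) * a) = a" for i a
      using \<gamma>_pos[of i] p_pos[of i] by simp
    then show ?thesis
      by (simp only: power2_norm_eq_inner inner_vec_def)
  qed
  also have "\<dots> \<le> (\<Sum>i\<in>UNIV. (\<Sum>i\<in>UNIV. \<gamma> i * p i) * (1 / (\<gamma> i * p i) * (norm (x $ i))\<^sup>2))"
    using pos by (intro sum_mono mult_right_mono member_le_sum) (auto simp: less_imp_le)
  also have "\<dots> = (\<Sum>i\<in>UNIV. \<gamma> i * p i) * N x"
    by (simp add: N_def sum_distrib_left)
  finally show ?thesis .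
qed

lemma N_eq_0: "N x = 0 \<Longrightarrow> x = 0"
  using norm_sq_le_N[of x] by simp

definition minimizers :: "('a ^ 'm) set" where
  "minimizers = {s \<in> Fdom. \<forall>y\<in>Fdom. Fr s \<le> Fr y}"

lemma weak_limit_minimizer:
  assumes X: "\<And>n. X n \<in> Fdom" and s: "s \<in> minimizers" and F: "(\<lambda>n. Fr (X n)) \<longlonglongrightarrow> Fr s"
    and lim: "\<And>y. (\<lambda>n. X n \<bullet> y) \<longlonglongrightarrow> l \<bullet> y"
  shows "l \<in> minimizers"
proof -
  have l: "l \<in> {x \<in> Fdom. Fr x \<le> Fr s + e}" if "e > 0" for e
  proof (rule weak_limit_in_closed_convex[OF closed_sublevel convex_sublevel _ lim])
    have "eventually (\<lambda>n. Fr (X n) < Fr s + e) sequentially"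
      using that by (intro order_tendstoD(2)[OF F]) simp
    then show "eventually (\<lambda>n. X n \<in> {x \<in> Fdom. Fr x \<le> Fr s + e}) sequentially"
      by eventually_elim (use X in auto)
  qed
  have "Fr l \<le> Fr s"
    by (rule field_le_epsilon) (use l in auto)
  then have "Fr l \<le> Fr y" if "y \<in> Fdom" for y
    using s that order_trans unfolding minimizers_def by blast
  with l[of 1] show ?thesis
    by (simp add: minimizers_def)
qed

end

section \<open>Convergence of the iterates\<close>

text \<open>At least \<open>n / 2\<close> terms have an index from \<open>n div 2\<close> to
  \<open>n - 1\<close>, and each is at least \<open>a n\<close>, so \<open>n * a n\<close> is at
  most twice a tail of the series.\<close>

lemma decreasing_summable_imp_tendsto:
  fixes a :: "nat \<Rightarrow> real"
  assumes dec: "decseq a" and nonneg: "\<And>n. a n \<ge> 0" and sum: "summable a"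
  shows "(\<lambda>n. real n * a n) \<longlonglongrightarrow> 0"
proof (rule tendsto_sandwich)
  show "\<forall>\<^sub>F n in sequentially. 0 \<le> real n * a n"
    using nonneg by simp
  have "real n * a n \<le> 2 * (\<Sum>k. a (k + n div 2))" for n
  proof -
    have "real (n - n div 2) * a n = (\<Sum>k<n - n div 2. a n)"
      by simp
    also have "\<dots> \<le> (\<Sum>k<n - n div 2. a (k + n div 2))"
      by (intro sum_mono decseqD[OF dec]) auto
    also have "\<dots> \<le> (\<Sum>k. a (k + n div 2))"
      using sum nonneg by (intro sum_le_suminf) (auto simp: summable_iff_shift)
    finally have "2 * (real (n - n div 2) * a n) \<le> 2 * (\<Sum>k. a (k + n div 2))"
      by simp
    moreover have "real n \<le> 2 * real (n - n div 2)"
      by linarith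
    then have "real n * a n \<le> 2 * real (n - n div 2) * a n"
      using nonneg by (intro mult_right_mono) auto
    ultimately show ?thesis
      by (metis mult.assoc order_trans)
  qed
  then show "\<forall>\<^sub>F n in sequentially. real n * a n \<le> 2 * (\<Sum>k. a (k + n div 2))"
    by simp
  have "filterlim (\<lambda>n::nat. n div 2) sequentially sequentially"
    by (rule filterlim_at_top_div_const_nat) simp
  from filterlim_compose[OF suminf_exist_split2[OF sum] this]
  have "(\<lambda>n. 2 * (\<Sum>k. a (k + n div 2))) \<longlonglongrightarrow> 2 * 0"
    by (intro tendsto_mult tendsto_const)
  then show "(\<lambda>n. 2 * (\<Sum>k. a (k + n div 2))) \<longlonglongrightarrow> 0"
    by simp
qed simp

locale random_block_prox_gradient =
  iid_finite M \<xi> q + block_prox_gradient V f h q p \<nu> \<gamma>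
  for M :: "'w measure" and \<xi> :: "nat \<Rightarrow> 'w \<Rightarrow> 'm::finite \<Rightarrow> bool" and q
    and V :: "'m \<Rightarrow> 'a::{real_inner, complete_space, second_countable_topology} set"
    and f h p \<nu> \<gamma> +
  fixes x0 :: "'a ^ 'm"
  assumes x0: "x0 \<in> Fdom"
begin

primrec X :: "('m \<Rightarrow> bool) list \<Rightarrow> 'a ^ 'm" where
  "X [] = x0"
| "X (e # l) = step (X l) e"

lemma X_Fdom: "X l \<in> Fdom"
  by (induction l) (auto simp: x0 step_in_Fdom)

definition EF :: "nat \<Rightarrow> real" where
  "EF n = (\<integral>\<omega>. Fr (X (hist n \<omega>)) \<partial>M)"

lemma EF_0: "EF 0 = Fr x0"
  by (simp add: EF_def prob_space)

lemma EF_decseq: "decseq EF"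
proof (rule decseq_SucI)
  fix n
  show "EF (Suc n) \<le> EF n"
    unfolding EF_def integral_hist_Suc[of "\<lambda>l. Fr (X l)"]
    using integrable_hist[of "\<lambda>l. \<Sum>e\<in>UNIV. q e * Fr (X (e # l))"] integrable_hist[of "\<lambda>l. Fr (X l)"]
      expected_Fr_le[OF X_Fdom]
    by (intro integral_mono) auto
qed

lemma EF_ge:
  assumes "\<And>y. y \<in> Fdom \<Longrightarrow> b \<le> Fr y"
  shows "b \<le> EF n"
proof -
  have "(\<integral>\<omega>. b \<partial>M) \<le> EF n"
    unfolding EF_def using assms X_Fdom by (intro integral_mono integrable_hist) auto
  then show ?thesis
    by (simp add: prob_space)
qed

text \<open>Summing the one-step estimate telescopes the Lyapunov terms; at the end the distance is
  dropped and \<open>c * EF n\<close> kept, which later supplies one more copy of the gap.\<close>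

lemma telescoped_estimate:
  assumes z: "z \<in> Fdom"
  shows "(\<Sum>k<n. EF k - Fr z) + c * EF n \<le> N (x0 - z) / 2 + c * Fr x0"
proof -
  define g where "g l = N (X l - z) / 2 + c * Fr (X l)" for l
  have int: "integrable M (\<lambda>\<omega>. (u :: _ \<Rightarrow> real) (hist n \<omega>))" for u n
    by (rule integrable_hist)
  have "(\<Sum>k<n. EF k - Fr z) + (\<integral>\<omega>. g (hist n \<omega>) \<partial>M) \<le> g []"
  proof (induction n)
    case 0
    then show ?case
      by (simp add: prob_space)
  next
    case (Suc n)
    have "(\<integral>\<omega>. g (hist (Suc n) \<omega>) \<partial>M)
        \<le> (\<integral>\<omega>. g (hist n \<omega>) - (Fr (X (hist n \<omega>)) - Fr z) \<partial>M)"
      unfolding integral_hist_Suc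
      using expected_lyapunov_le[OF X_Fdom z] int[of "\<lambda>l. \<Sum>e\<in>UNIV. q e * g (e # l)"]
        int[of "\<lambda>l. g l - (Fr (X l) - Fr z)"]
      by (intro integral_mono) (auto simp: g_def)
    also have "\<dots> = (\<integral>\<omega>. g (hist n \<omega>) \<partial>M) - (EF n - Fr z)"
      unfolding EF_def using int[of g] int[of "\<lambda>l. Fr (X l)"] by (simp add: prob_space)
    finally show ?case
      using Suc by simp
  qed
  moreover have "c * EF n \<le> (\<integral>\<omega>. g (hist n \<omega>) \<partial>M)"
  proof -
    have "c * EF n = (\<integral>\<omega>. c * Fr (X (hist n \<omega>)) \<partial>M)"
      by (simp add: EF_def)
    also have "\<dots> \<le> (\<integral>\<omega>. g (hist n \<omega>) \<partial>M)"
      using N_nonneg int[of "\<lambda>l. c * Fr (X l)"] int[of g] by (intro integral_mono) (auto simp: g_def)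
    finally show ?thesis .
  qed
  ultimately show ?thesis
    by (simp add: g_def)
qed

text \<open>Otherwise the sum of the gaps would grow linearly against a bound independent of
  \<open>n\<close>. With \<open>z\<close> ranging over the domain this also covers an infimum
  \<open>- \<infinity>\<close>.\<close>

lemma EF_eventually_below:
  assumes z: "z \<in> Fdom" and e: "e > 0"
  shows "\<exists>n. EF n < Fr z + e"
proof (rule ccontr)
  assume "\<not> ?thesis"
  then have ge: "Fr z + e \<le> EF n" for n
    by (simp add: not_less)
  define R where "R = N (x0 - z) / 2 + c * Fr x0 - c * (Fr z + e)"
  have "real n * e \<le> R" for n
  proof -
    have "real n * e = (\<Sum>k<n. e)"
      by simp
    also have "\<dots> \<le> (\<Sum>k<n. EF k - Fr z)"
      using ge by (intro sum_mono) (simp add: le_diff_eq add.commute)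
    also have "\<dots> \<le> N (x0 - z) / 2 + c * Fr x0 - c * EF n"
      using telescoped_estimate[OF z, of n] by simp
    also have "\<dots> \<le> R"
      unfolding R_def using ge[of n] c_ge_1 by simp
    finally show ?thesis .
  qed
  moreover obtain n where "R < real n * e"
    using e reals_Archimedean3 by blast
  ultimately show False
    by (meson not_less)
qed

section \<open>Rates and almost sure convergence in the presence of a minimizer\<close>

context
  fixes s assumes s: "s \<in> minimizers"
begin

lemma Fr_ge: "y \<in> Fdom \<Longrightarrow> Fr s \<le> Fr y" and s_Fdom: "s \<in> Fdom"
  using s by (auto simp: minimizers_def)

lemma EF_ge_min: "Fr s \<le> EF n"
  by (rule EF_ge) (rule Fr_ge)

lemma EF_summable: "summable (\<lambda>n. EF n - Fr s)"
proof (rule summableI_nonneg_bounded)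
  show "0 \<le> EF n - Fr s" for n
    using EF_ge_min by simp
  show "(\<Sum>k<n. EF k - Fr s) \<le> N (x0 - s) / 2 + c * Fr x0 - c * Fr s" for n
  proof -
    have "c * Fr s \<le> c * EF n"
      using EF_ge_min c_ge_1 by (intro mult_left_mono) auto
    then show ?thesis
      using telescoped_estimate[OF s_Fdom, of n] by simp
  qed
qed

lemma EF_rate: "(\<lambda>n. real n * (EF n - Fr s)) \<longlonglongrightarrow> 0"
  using EF_decseq EF_ge_min EF_summable
  by (intro decreasing_summable_imp_tendsto) (auto simp: decseq_def)

text \<open>Monotonicity bounds \<open>n - 1\<close> copies of the gap by the terms 1 to
  \<open>n - 1\<close> of the telescoped sum. The term 0 is the initial gap and lowers the
  coefficient \<open>c\<close> to \<open>c - 1\<close>; the term \<open>c * EF n\<close> supplies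
  the remaining copy.\<close>

lemma EF_bound: "real n * (EF n - Fr s) \<le> N (x0 - s) / 2 + (c - 1) * (Fr x0 - Fr s)"
proof (cases n)
  case 0
  then show ?thesis
    using N_nonneg[of "x0 - s"] c_ge_1 Fr_ge[OF x0] by simp
next
  case (Suc m)
  have "real m * (EF n - Fr s) = (\<Sum>k<m. EF n - Fr s)"
    by simp
  also have "\<dots> \<le> (\<Sum>k<m. EF (Suc k) - Fr s)"
    using Suc by (intro sum_mono diff_right_mono decseqD[OF EF_decseq]) auto
  also have "\<dots> = (\<Sum>k<n. EF k - Fr s) - (Fr x0 - Fr s)"
    unfolding Suc sum.lessThan_Suc_shift by (simp add: EF_0)
  also have "\<dots> \<le> N (x0 - s) / 2 + c * Fr x0 - c * EF n - (Fr x0 - Fr s)"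
    using telescoped_estimate[OF s_Fdom, of n] by simp
  finally have "real m * (EF n - Fr s) + (EF n - Fr s)
      \<le> N (x0 - s) / 2 + (c - 1) * (Fr x0 - Fr s) - (c - 1) * (EF n - Fr s)"
    by (simp add: algebra_simps)
  moreover have "(c - 1) * (EF n - Fr s) \<ge> 0"
    using c_ge_1 EF_ge_min by simp
  ultimately show ?thesis
    using Suc by (simp add: algebra_simps)
qed

lemma AE_Fr_tendsto: "AE \<omega> in M. (\<lambda>n. Fr (X (hist n \<omega>))) \<longlonglongrightarrow> Fr s"
proof -
  have "(\<integral>\<omega>. Fr (X (hist n \<omega>)) - Fr s \<partial>M) = EF n - Fr s" for n
    unfolding EF_def using integrable_hist[of "\<lambda>l. Fr (X l)"] by (simp add: prob_space)
  then have "AE \<omega> in M. (\<lambda>n. Fr (X (hist n \<omega>)) - Fr s) \<longlonglongrightarrow> 0"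
    using AE_tendsto_0_if_summable_expectation[of "\<lambda>l. Fr (X l) - Fr s"] Fr_ge[OF X_Fdom] EF_summable
    by simp
  then show ?thesis
    by eventually_elim (simp add: LIM_zero_iff)
qed

lemma AE_convergent_N: "AE \<omega> in M. convergent (\<lambda>n. N (X (hist n \<omega>) - s))"
proof -
  define Y where "Y l = N (X l - s) / 2 + c * Fr (X l) - c * Fr s" for l
  have "Y l \<ge> 0" for l
  proof -
    have "c * Fr s \<le> c * Fr (X l)"
      using Fr_ge[OF X_Fdom] c_ge_1 by (intro mult_left_mono) auto
    then show ?thesis
      using N_nonneg[of "X l - s"] by (simp add: Y_def)
  qed
  moreover have "(\<Sum>e\<in>UNIV. q e * Y (e # l)) \<le> Y l" for l
  proof -
    have "(\<Sum>e\<in>UNIV. q e * Y (e # l))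
        = (\<Sum>e\<in>UNIV. q e * (N (step (X l) e - s) / 2 + c * Fr (step (X l) e))) - c * Fr s"
      using sum_q by (simp add: Y_def right_diff_distrib sum_subtractf sum_distrib_right[symmetric])
    also have "\<dots> \<le> Y l"
      using expected_lyapunov_le[OF X_Fdom[of l] s_Fdom] Fr_ge[OF X_Fdom[of l]] by (simp add: Y_def)
    finally show ?thesis .
  qed
  ultimately have "AE \<omega> in M. convergent (\<lambda>n. Y (hist n \<omega>))"
    by (rule AE_convergent_supermartingale)
  with AE_Fr_tendsto show ?thesis
  proof eventually_elim
    case (elim \<omega>)
    then obtain L where L: "(\<lambda>n. Y (hist n \<omega>)) \<longlonglongrightarrow> L"
      by (auto simp: convergent_def)
    have "(\<lambda>n. 2 * (Y (hist n \<omega>) - c * Fr (X (hist n \<omega>)) + c * Fr s)) \<longlonglongrightarrow> 2 * (L - c * Fr s + c * Fr s)"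
      using elim(1) by (intro tendsto_intros L)
    moreover have "2 * (Y l - c * Fr (X l) + c * Fr s) = N (X l - s)" for l
      by (simp add: Y_def)
    ultimately show ?case
      by (auto simp: convergent_def)
  qed
qed

end

lemma AE_weakly_convergent:
  assumes ne: "minimizers \<noteq> {}"
  shows "AE \<omega> in M. \<exists>l\<in>minimizers. \<forall>y. (\<lambda>n. X (hist n \<omega>) \<bullet> y) \<longlonglongrightarrow> l \<bullet> y"
proof -
  obtain T where T: "countable T" "T \<subseteq> minimizers" "minimizers \<subseteq> closure T"
    using countable_dense_subset by blast
  then obtain t where t: "t \<in> T"
    using ne by fastforce
  then have t': "t \<in> minimizers"
    using T(2) by blast
  have "AE \<omega> in M. \<forall>z\<in>T. convergent (\<lambda>n. N (X (hist n \<omega>) - z))"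
    using AE_convergent_N T(2) by (subst AE_ball_countable[OF T(1)]) blast
  then show ?thesis
    using AE_Fr_tendsto[OF t']
  proof eventually_elim
    case (elim \<omega>)
    define x where "x n = X (hist n \<omega>)" for n
    obtain K where K: "\<And>n. norm (x n) \<le> K"
    proof -
      have "Bseq (\<lambda>n. N (x n - t))"
        using elim(1) t unfolding x_def by (intro convergent_imp_Bseq) blast
      then obtain b where b: "\<And>n. norm (N (x n - t)) \<le> b"
        unfolding Bseq_def by blast
      have "norm (x n) \<le> sqrt ((\<Sum>i\<in>UNIV. \<gamma> i * p i) * b) + norm t" for n
      proof -
        have "(norm (x n - t))\<^sup>2 \<le> (\<Sum>i\<in>UNIV. \<gamma> i * p i) * N (x n - t)"
          by (rule norm_sq_le_N)
        also have "\<dots> \<le> (\<Sum>i\<in>UNIV. \<gamma> i * p i) * b"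
          using b[of n] \<gamma>_pos p_pos by (intro mult_left_mono sum_nonneg) (auto simp: less_imp_le)
        finally have "norm (x n - t) \<le> sqrt ((\<Sum>i\<in>UNIV. \<gamma> i * p i) * b)"
          by (rule real_le_rsqrt)
        then show ?thesis
          using norm_triangle_ineq[of "x n - t" t] by simp
      qed
      then show thesis
        by (rule that)
    qed
    \<comment> \<open>For a fixed outcome the passage from the dense set to all minimizers is
      deterministic, so no uncountable union of null sets arises.\<close>
    have conv: "convergent (\<lambda>n. (x n - z) \<bullet> W (x n - z))" if "z \<in> minimizers" for z
    proof (rule convergent_quadratic_closure[OF K W_linear W_selfadjoint])
      show "z \<in> closure T"
        using that T(3) by blast
      show "convergent (\<lambda>n. (x n - z) \<bullet> W (x n - z))" if "z \<in> T" for z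
        using elim(1) that unfolding x_def N_eq by blast
    qed
    obtain l where "l \<in> minimizers" "\<And>y. (\<lambda>n. x n \<bullet> y) \<longlonglongrightarrow> l \<bullet> y"
    proof (rule opial[where X = x and B = K and W = W and S = minimizers])
      show "linear W"
        using W_linear by (rule bounded_linear.linear)
      show "x = 0" if "x \<bullet> W x = 0" for x
        using that N_eq_0 by (simp add: N_eq)
      show "l \<in> minimizers"
        if r: "strict_mono r" and lim: "\<And>y. (\<lambda>n. x (r n) \<bullet> y) \<longlonglongrightarrow> l \<bullet> y" for r l
      proof (rule weak_limit_minimizer[OF _ t' _ lim])
        show "(\<lambda>n. Fr (x (r n))) \<longlonglongrightarrow> Fr t"
          using LIMSEQ_subseq_LIMSEQ[OF elim(2) r] by (simp add: o_def x_def)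
      qed (simp add: x_def X_Fdom)
    qed (use K conv W_selfadjoint in auto)
    then show ?case
      unfolding x_def by blast
  qed
qed

end

section \<open>Transfer to the random variables of the statement\<close>

theorem theorem4p9:
  fixes V :: "'m::finite \<Rightarrow> 'a::{real_inner, complete_space, second_countable_topology} set"
    and H :: "('a ^ 'm) set"
    and f :: "'a ^ 'm \<Rightarrow> real"
    and h :: "'m \<Rightarrow> 'a \<Rightarrow> ereal"
    and F :: "'a ^ 'm \<Rightarrow> ereal"
    and M :: "'w measure"
    and eps :: "'w \<Rightarrow> 'm \<Rightarrow> bool"
    and epsn :: "nat \<Rightarrow> 'w \<Rightarrow> 'm \<Rightarrow> bool"
    and p \<nu> \<gamma> :: "'m \<Rightarrow> real"
    and x0 :: "'a ^ 'm"
    and x :: "nat \<Rightarrow> 'w \<Rightarrow> 'a ^ 'm"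
    and \<delta> p_min :: real
    and F_inf :: ereal
    and S :: "('a ^ 'm) set"
  assumes V_subspace: "\<And>i. subspace (V i)"
    and V_closed: "\<And>i. closed (V i)"
    and H_def: "H = direct_sum V"
    and f_convex: "convex_on H f"
    and f_diff: "\<And>y. y \<in> H \<Longrightarrow> f differentiable (at y within H)"
    and h_proper: "\<And>i. proper_on (V i) (h i)"
    and h_convex: "\<And>i. ereal_convex_on (V i) (h i)"
    and h_lsc: "\<And>i. lsc_on (V i) (h i)"
    and F_def: "\<And>y. F y = ereal (f y) + separable_sum h y"
    and M_prob: "prob_space M"
    and eps_measurable: "eps \<in> measurable M (count_space UNIV)"
    and p_def: "\<And>i. p i = measure M {\<omega> \<in> space M. eps \<omega> i}"
    and p_pos: "\<And>i. p i > 0"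
    and eps_nonzero: "measure M {\<omega> \<in> space M. \<forall>i. \<not> eps \<omega> i} = 0"
    and epsn_indep: "prob_space.indep_vars M (\<lambda>_. count_space UNIV) epsn UNIV"
    and epsn_copies: "\<And>n. distr M (count_space UNIV) (epsn n) = distr M (count_space UNIV) eps"
    and \<nu>_pos: "\<And>i. \<nu> i > 0"
    and smooth: "\<And>y v. y \<in> H \<Longrightarrow> v \<in> H \<Longrightarrow>
      (\<integral>\<omega>. f (y + eps \<omega> \<odot> v) \<partial>M)
        \<le> f y + (\<integral>\<omega>. gradient_on H f y \<bullet> (eps \<omega> \<odot> v) \<partial>M)
          + 1 / 2 * (\<Sum>i\<in>UNIV. p i * \<nu> i * (norm (v $ i))\<^sup>2)"
    and \<gamma>_pos: "\<And>i. 0 < \<gamma> i"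
    and \<gamma>_less: "\<And>i. \<gamma> i < 2 / \<nu> i"
    and x0_H: "x0 \<in> H"
    and x0_dom: "separable_sum h x0 < \<infinity>"
    and x_0: "\<And>\<omega>. \<omega> \<in> space M \<Longrightarrow> x 0 \<omega> = x0"
    and x_Suc: "\<And>n \<omega> i. \<omega> \<in> space M \<Longrightarrow>
      x (Suc n) \<omega> $ i = x n \<omega> $ i + of_bool (epsn n \<omega> i) *\<^sub>R
        (prox_on (V i) (\<lambda>z. ereal (\<gamma> i) * h i z)
           (x n \<omega> $ i - \<gamma> i *\<^sub>R (gradient_on H f (x n \<omega>) $ i)) - x n \<omega> $ i)"
    and \<delta>_def: "\<delta> = Max (range (\<lambda>i. \<gamma> i * \<nu> i))"
    and p_min_def: "p_min = Min (range p)"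
    and F_inf_def: "F_inf = (INF y\<in>H. F y)"
    and S_def: "S = argmin_set H F"
  shows "((\<lambda>n. ereal_expectation M (\<lambda>\<omega>. F (x n \<omega>))) \<longlonglongrightarrow> F_inf) \<and>
    (S \<noteq> {} \<longrightarrow>
      (\<lambda>n. real_of_ereal (ereal_expectation M (\<lambda>\<omega>. F (x n \<omega>)) - F_inf)) \<in> o(\<lambda>n. 1 / real n) \<and>
      (\<forall>n\<ge>1. ereal_expectation M (\<lambda>\<omega>. F (x n \<omega>)) - F_inf
        \<le> (ereal ((dist_W \<gamma> p x0 S)\<^sup>2 / 2)
            + ereal (max 1 (1 / (2 - \<delta>)) / p_min - 1) * (F x0 - F_inf)) * ereal (1 / real n)) \<and>
      (\<exists>xs. xs \<in> borel_measurable M \<and> (\<forall>\<omega>\<in>space M. xs \<omega> \<in> S) \<and>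
        (AE \<omega> in M. weakly_tendsto_on H (\<lambda>n. x n \<omega>) (xs \<omega>))))"
proof -
  interpret prob_space M by fact
  \<comment> \<open>The law of \<open>eps\<close> as weights on masks; every \<open>epsn n\<close>
    shares it, and expectations over \<open>eps\<close> become finite sums.\<close>
  define q where "q e = prob (eps -` {e} \<inter> space M)" for e
  have epsn_meas: "epsn n \<in> measurable M (count_space UNIV)" for n
    using epsn_indep by (auto simp: indep_vars_def)
  have q_n: "prob (epsn n -` {e} \<inter> space M) = q e" for n e
    using measure_distr[OF epsn_meas, of "{e}" n] measure_distr[OF eps_measurable, of "{e}"]
    by (simp add: q_def epsn_copies)
  have int_eps: "(\<integral>\<omega>. g (eps \<omega>) \<partial>M) = (\<Sum>e\<in>UNIV. q e * g e)" for g :: "_ \<Rightarrow> real"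
    using integral_finite_range[OF eps_measurable, of UNIV g] by (simp add: q_def mult.commute)
  have p_eq: "p i = (\<Sum>e\<in>UNIV. q e * of_bool (e i))" for i
  proof -
    have [measurable]: "{\<omega> \<in> space M. eps \<omega> i} \<in> sets M"
      using measurable_sets[OF eps_measurable, of "{e. e i}"] by (simp add: vimage_def Int_def conj_commute)
    have "p i = (\<integral>\<omega>. indicator {\<omega> \<in> space M. eps \<omega> i} \<omega> \<partial>M)"
      by (simp add: p_def)
    also have "\<dots> = (\<integral>\<omega>. of_bool (eps \<omega> i) \<partial>M)"
      by (intro Bochner_Integration.integral_cong) (auto simp: indicator_def)
    also have "\<dots> = (\<Sum>e\<in>UNIV. q e * of_bool (e i))"
      by (rule int_eps)
    finally show ?thesis .
  qed
  interpret R: iid_finite M epsn q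
    using epsn_indep q_n by unfold_locales
  interpret R: block_prox_gradient V f h q p \<nu> \<gamma>
  proof
    show "\<gamma> i * \<nu> i < 2" for i
      using \<gamma>_less[of i] \<nu>_pos[of i] by (simp add: field_simps)
    fix y v assume y: "y \<in> direct_sum V" and v: "v \<in> direct_sum V"
    have "(\<integral>\<omega>. gradient_on H f y \<bullet> (eps \<omega> \<odot> v) \<partial>M)
        = (\<Sum>e\<in>UNIV. q e * (gradient_on H f y \<bullet> (e \<odot> v)))"
      by (rule int_eps)
    also have "\<dots> = (\<Sum>e\<in>UNIV. \<Sum>i\<in>UNIV. q e * of_bool (e i) * (gradient_on H f y $ i \<bullet> v $ i))"
      unfolding inner_vec_def mask_def sum_distrib_left by (intro sum.cong refl) simp
    also have "\<dots> = (\<Sum>i\<in>UNIV. p i * (gradient_on H f y $ i \<bullet> v $ i))"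
      unfolding p_eq sum_distrib_right by (rule sum.swap)
    finally show "(\<Sum>e\<in>UNIV. q e * f (y + e \<odot> v))
        \<le> f y + (\<Sum>i\<in>UNIV. p i * (gradient_on (direct_sum V) f y $ i \<bullet> v $ i))
          + 1 / 2 * (\<Sum>i\<in>UNIV. p i * \<nu> i * (norm (v $ i))\<^sup>2)"
      using smooth[of y v] y v by (simp add: H_def int_eps[of "\<lambda>e. f (y + e \<odot> v)"])
  qed (use V_subspace V_closed f_convex f_diff h_proper h_convex h_lsc p_pos \<gamma>_pos p_eq R.q_nonneg R.sum_q
      in \<open>auto simp: H_def\<close>)
  interpret R: random_block_prox_gradient M epsn q V f h p \<nu> \<gamma> x0
    by unfold_locales (use R.F_finite_iff x0_H x0_dom in \<open>auto simp: H_def\<close>)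

  \<comment> \<open>On the sample space the iterates are a deterministic function of the history;
    the recursion is known only there.\<close>
  have x_eq: "x n \<omega> = R.X (R.hist n \<omega>)" if "\<omega> \<in> space M" for n \<omega>
  proof (induction n)
    case 0
    then show ?case
      using x_0 that by simp
  next
    case (Suc n)
    show ?case
      unfolding vec_eq_iff by (simp add: x_Suc[OF that] Suc R.step_nth R.T_def H_def)
  qed
  have F_Fdom: "F y = ereal (R.Fr y)" if "y \<in> R.Fdom" for y
    using R.F_real[OF that] by (simp add: F_def)
  have F_infty: "F y = \<infinity>" if "y \<in> H" "y \<notin> R.Fdom" for y
    using R.F_finite_iff[of y] that by (simp add: F_def H_def)
  have E_eq: "ereal_expectation M (\<lambda>\<omega>. F (x n \<omega>)) = ereal (R.EF n)" for n
  proof -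
    have "ereal_expectation M (\<lambda>\<omega>. F (x n \<omega>)) = ereal_expectation M (\<lambda>\<omega>. ereal (R.Fr (R.X (R.hist n \<omega>))))"
      by (rule ereal_expectation_cong) (simp add: x_eq F_Fdom R.X_Fdom)
    then show ?thesis
      using ereal_expectation_real[OF R.integrable_hist[of "\<lambda>l. R.Fr (R.X l)"]] by (simp add: R.EF_def)
  qed
  have Fdom_H: "y \<in> H" if "y \<in> R.Fdom" for y
    using R.FdomD(1)[OF that] by (simp add: H_def)

  \<comment> \<open>In \<open>ereal\<close> a decreasing sequence tends to its infimum even if this
    is \<open>- \<infinity>\<close>, so only two infima have to be compared.\<close>
  have "(\<lambda>n. ereal (R.EF n)) \<longlonglongrightarrow> (INF n. ereal (R.EF n))"
    using R.EF_decseq by (intro LIMSEQ_INF) (auto simp: decseq_def)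
  also have "(INF n. ereal (R.EF n)) = F_inf"
  proof (rule antisym)
    show "(INF n. ereal (R.EF n)) \<le> F_inf"
      unfolding F_inf_def
    proof (rule INF_greatest)
      fix y assume y: "y \<in> H"
      show "(INF n. ereal (R.EF n)) \<le> F y"
      proof (cases "y \<in> R.Fdom")
        case True
        show ?thesis
          unfolding F_Fdom[OF True]
        proof (rule ereal_le_epsilon2)
          fix e :: real assume "e > 0"
          then obtain n where "R.EF n < R.Fr y + e"
            using R.EF_eventually_below[OF True] by blast
          then show "(INF n. ereal (R.EF n)) \<le> ereal (R.Fr y) + ereal e"
            by (intro INF_lower2[of n]) auto
        qed
      qed (simp add: F_infty y)
    qed
    show "F_inf \<le> (INF n. ereal (R.EF n))"
    proof (rule INF_greatest)
      fix n
      have F_inf_le: "F_inf \<le> ereal (R.Fr y)" if "y \<in> R.Fdom" for y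
        unfolding F_inf_def F_Fdom[OF that, symmetric] using Fdom_H[OF that] by (rule INF_lower)
      show "F_inf \<le> ereal (R.EF n)"
      \<comment> \<open>The value at \<open>x0\<close> excludes \<open>\<infinity>\<close>; for
        \<open>- \<infinity>\<close> nothing is to be shown.\<close>
      proof (cases F_inf)
        case (real b)
        then show ?thesis
          using R.EF_ge[of b n] F_inf_le by simp
      next
        case PInf
        then show ?thesis
          using F_inf_le[OF R.x0] by simp
      qed simp
    qed
  qed
  finally have i: "(\<lambda>n. ereal_expectation M (\<lambda>\<omega>. F (x n \<omega>))) \<longlonglongrightarrow> F_inf"
    by (simp only: E_eq)

  have S_eq: "S = R.minimizers"
  proof (intro equalityI subsetI)
    fix s assume "s \<in> S"
    then have s: "s \<in> H" "\<And>y. y \<in> H \<Longrightarrow> F s \<le> F y"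
      by (auto simp: S_def argmin_set_def is_arg_min_def not_less)
    have "F s \<le> ereal (R.Fr x0)"
      using s(2)[OF x0_H] by (simp add: F_Fdom R.x0)
    then have sF: "s \<in> R.Fdom"
      using F_infty[OF s(1)] by force
    have "R.Fr s \<le> R.Fr y" if "y \<in> R.Fdom" for y
      using s(2)[OF Fdom_H[OF that]] by (simp add: F_Fdom that sF)
    with sF show "s \<in> R.minimizers"
      by (simp add: R.minimizers_def)
  next
    fix s assume s: "s \<in> R.minimizers"
    then have sF: "s \<in> R.Fdom"
      by (rule R.s_Fdom)
    have "F s \<le> F y" if "y \<in> H" for y
      using R.Fr_ge[OF s, of y] F_infty[OF that] by (cases "y \<in> R.Fdom") (auto simp: F_Fdom sF)
    then show "s \<in> S"
      using Fdom_H[OF sF] by (auto simp: S_def argmin_set_def is_arg_min_def not_less)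
  qed

  have ii: "(\<lambda>n. real_of_ereal (ereal_expectation M (\<lambda>\<omega>. F (x n \<omega>)) - F_inf)) \<in> o(\<lambda>n. 1 / real n) \<and>
      (\<forall>n\<ge>1. ereal_expectation M (\<lambda>\<omega>. F (x n \<omega>)) - F_inf
        \<le> (ereal ((dist_W \<gamma> p x0 S)\<^sup>2 / 2)
            + ereal (max 1 (1 / (2 - \<delta>)) / p_min - 1) * (F x0 - F_inf)) * ereal (1 / real n)) \<and>
      (\<exists>xs. xs \<in> borel_measurable M \<and> (\<forall>\<omega>\<in>space M. xs \<omega> \<in> S) \<and>
        (AE \<omega> in M. weakly_tendsto_on H (\<lambda>n. x n \<omega>) (xs \<omega>)))" if S_ne: "S \<noteq> {}"
  proof -
    obtain s where s: "s \<in> R.minimizers"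
      using S_ne S_eq by blast
    have same: "R.Fr z = R.Fr s" if "z \<in> R.minimizers" for z
      using R.Fr_ge[OF s R.s_Fdom[OF that]] R.Fr_ge[OF that R.s_Fdom[OF s]] by simp
    have F_inf: "F_inf = ereal (R.Fr s)"
    proof (rule antisym)
      show "F_inf \<le> ereal (R.Fr s)"
        unfolding F_inf_def F_Fdom[OF R.s_Fdom[OF s], symmetric]
        using Fdom_H[OF R.s_Fdom[OF s]] by (rule INF_lower)
      show "ereal (R.Fr s) \<le> F_inf"
        unfolding F_inf_def
      proof (rule INF_greatest)
        fix y assume "y \<in> H"
        then show "ereal (R.Fr s) \<le> F y"
          using R.Fr_ge[OF s, of y] F_infty by (cases "y \<in> R.Fdom") (auto simp: F_Fdom)
      qed
    qed
    have diff: "ereal_expectation M (\<lambda>\<omega>. F (x n \<omega>)) - F_inf = ereal (R.EF n - R.Fr s)" for n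
      by (simp add: E_eq F_inf)

    have "(\<lambda>n. real_of_ereal (ereal_expectation M (\<lambda>\<omega>. F (x n \<omega>)) - F_inf)) \<in> o(\<lambda>n. 1 / real n)"
    proof (rule smalloI_tendsto)
      have "(\<lambda>n. real_of_ereal (ereal_expectation M (\<lambda>\<omega>. F (x n \<omega>)) - F_inf) / (1 / real n))
          = (\<lambda>n. real n * (R.EF n - R.Fr s))"
        by (simp add: diff mult.commute)
      then show "(\<lambda>n. real_of_ereal (ereal_expectation M (\<lambda>\<omega>. F (x n \<omega>)) - F_inf) / (1 / real n)) \<longlonglongrightarrow> 0"
        using R.EF_rate[OF s] by simp
      \<comment> \<open>At \<open>n = 0\<close> the value \<open>1 / real n\<close> is 0 by
        convention, so it is nonzero only eventually.\<close>
      show "\<forall>\<^sub>F n in sequentially. 1 / real n \<noteq> 0"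
        using eventually_gt_at_top[of 0] by eventually_elim simp
    qed
    moreover have "ereal_expectation M (\<lambda>\<omega>. F (x n \<omega>)) - F_inf
        \<le> (ereal ((dist_W \<gamma> p x0 S)\<^sup>2 / 2)
            + ereal (max 1 (1 / (2 - \<delta>)) / p_min - 1) * (F x0 - F_inf)) * ereal (1 / real n)"
      if n: "n \<ge> 1" for n
    proof -
      have c: "max 1 (1 / (2 - \<delta>)) / p_min = R.c"
        by (simp add: R.c_def R.\<delta>_def R.p_min_def \<delta>_def p_min_def)
      \<comment> \<open>All minimizers have the same value, so \<open>EF_bound\<close> solved for
        the distance gives a lower bound \<open>K\<close> of \<open>R.N (x0 - z)\<close> that is
        independent of \<open>z\<close> and therefore passes to the infimum.\<close>
      define K where "K = 2 * (real n * (R.EF n - R.Fr s) - (R.c - 1) * (R.Fr x0 - R.Fr s))"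
      have K: "K \<le> R.N (x0 - z)" if "z \<in> S" for z
        using R.EF_bound[of z n] same[of z] that by (simp add: K_def S_eq)
      have "K \<le> (dist_W \<gamma> p x0 S)\<^sup>2"
      \<comment> \<open>The infimum is over distances, not their squares, so \<open>K\<close> enters
        through its square root; a nonpositive \<open>K\<close> is trivial.\<close>
      proof (cases "K \<le> 0")
        case True
        then show ?thesis
          by (meson order_trans zero_le_power2)
      next
        case False
        have "sqrt K \<le> dist_W \<gamma> p x0 S"
          unfolding dist_W_def norm_W_def R.N_def[symmetric] using S_ne K
          by (intro cINF_greatest real_sqrt_le_mono) auto
        then have "(sqrt K)\<^sup>2 \<le> (dist_W \<gamma> p x0 S)\<^sup>2"
          using False by (intro power_mono) auto
        then show ?thesis
          using False by simp
      qed
      then have "real n * (R.EF n - R.Fr s)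
          \<le> (dist_W \<gamma> p x0 S)\<^sup>2 / 2 + (R.c - 1) * (R.Fr x0 - R.Fr s)"
        by (simp add: K_def)
      then have "R.EF n - R.Fr s
          \<le> ((dist_W \<gamma> p x0 S)\<^sup>2 / 2 + (R.c - 1) * (R.Fr x0 - R.Fr s)) * (1 / real n)"
        using n by (simp add: pos_le_divide_eq mult.commute)
      then show ?thesis
        unfolding diff c by (simp add: F_inf F_Fdom R.x0)
    qed
    moreover obtain xs where xs: "xs \<in> borel_measurable M" "\<And>\<omega>. \<omega> \<in> space M \<Longrightarrow> xs \<omega> \<in> S"
      "AE \<omega> in M. \<forall>y. (\<lambda>n. R.X (R.hist n \<omega>) \<bullet> y) \<longlonglongrightarrow> xs \<omega> \<bullet> y"
    proof (rule measurable_weak_limit[of "\<lambda>n \<omega>. R.X (R.hist n \<omega>)" M s S])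
      show "(\<lambda>\<omega>. R.X (R.hist n \<omega>) \<bullet> y) \<in> borel_measurable M" for n y
        by (rule R.borel_measurable_hist)
      show "s \<in> S"
        using s by (simp add: S_eq)
      show "AE \<omega> in M. \<exists>l\<in>S. \<forall>y. (\<lambda>n. R.X (R.hist n \<omega>) \<bullet> y) \<longlonglongrightarrow> l \<bullet> y"
        using R.AE_weakly_convergent s unfolding S_eq by blast
    qed blast
    moreover have "AE \<omega> in M. weakly_tendsto_on H (\<lambda>n. x n \<omega>) (xs \<omega>)"
      using xs(3) AE_space by eventually_elim (simp add: weakly_tendsto_on_def x_eq)
    ultimately show ?thesis
      by blast
  qed
  from i ii show ?thesis
    by blast
qed

end
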